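(* Let $H_0$ be a self-adjoint operator on a Hilbert space $\mathcal{H}$, let $\psi\in\mathcal{H}$ with $\|\psi\|=1$, and for $\kappa\in\mathbb{R}$ let $H_\kappa=H_0+\kappa|\psi\rangle\langle\psi|$. Let $P$ be an orthogonal projection with $PH_0\subset H_0P$, $P^\perp=I-P$, and for $\Im z\ne0$ set $\mathcal{F}_0(z)=\langle\psi,P^\perp(P^\perp H_0P^\perp-z)^{-1}P^\perp\psi\rangle$. Let $J\subset\mathbb{R}$ be an open interval such that: (1) for every $\lambda\in J$ the limit $\mathcal{F}_0(\lambda+i0)=\lim_{\epsilon\downarrow0}\mathcal{F}_0(\lambda+i\epsilon)$ exists and $\Im\mathcal{F}_0(\lambda+i0)>0$; (2) whenever $H_0\varphi=\lambda\varphi$ with $\varphi\neq0$ and $\lambda\in J$, then $\langle\varphi,\psi\rangle\neq0$ and $\lambda$ is a simple eigenvalue of $H_0$. Then for every $\kappa\neq0$, $J\subset\sigma_{ac}(H_\kappa)$ and $J\cap\sigma_p(H_\kappa)=\emptyset$.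
   Context: $\sigma_{ac}$ and $\sigma_p$ denote the absolutely continuous spectrum and the set of eigenvalues. *)

theory Defs
  imports "HOL-Analysis.Analysis" "HOL-Probability.Probability"
begin

class complex_inner = real_normed_vector +
  fixes scaleC :: "complex \<Rightarrow> 'a \<Rightarrow> 'a"
    and cinner :: "'a \<Rightarrow> 'a \<Rightarrow> complex"
  assumes scaleC_add_right: "scaleC a (x + y) = scaleC a x + scaleC a y"
    and scaleC_add_left: "scaleC (a + b) x = scaleC a x + scaleC b x"
    and scaleC_scaleC: "scaleC a (scaleC b x) = scaleC (a * b) x"
    and scaleC_of_real: "scaleC (of_real r) x = scaleR r x"
    and cinner_conj: "cinner x y = cnj (cinner y x)"
    and cinner_add_right: "cinner x (y + z) = cinner x y + cinner x z"
    and cinner_scaleC_right: "cinner x (scaleC a y) = a * cinner x y"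
    and cinner_ge_zero: "0 \<le> Re (cinner x x)"
    and cinner_eq_zero_iff: "cinner x x = 0 \<longleftrightarrow> x = 0"
    and norm_eq_sqrt_cinner: "norm x = sqrt (Re (cinner x x))"

text \<open>A (possibly unbounded) operator is given by a domain D and a map A (relevant on D).\<close>

definition complex_subspace :: "'a::complex_inner set \<Rightarrow> bool" where
  "complex_subspace S \<longleftrightarrow> 0 \<in> S \<and> (\<forall>x\<in>S. \<forall>y\<in>S. x + y \<in> S) \<and> (\<forall>a. \<forall>x\<in>S. scaleC a x \<in> S)"

definition linear_on :: "'a::complex_inner set \<Rightarrow> ('a \<Rightarrow> 'a) \<Rightarrow> bool" where
  "linear_on D A \<longleftrightarrow> (\<forall>x\<in>D. \<forall>y\<in>D. A (x + y) = A x + A y) \<and> (\<forall>a. \<forall>x\<in>D. A (scaleC a x) = scaleC a (A x))"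

definition adjoint_domain :: "'a::complex_inner set \<Rightarrow> ('a \<Rightarrow> 'a) \<Rightarrow> 'a set" where
  "adjoint_domain D A = {y. \<exists>w. \<forall>x\<in>D. cinner y (A x) = cinner w x}"

definition self_adjoint :: "'a::complex_inner set \<Rightarrow> ('a \<Rightarrow> 'a) \<Rightarrow> bool" where
  "self_adjoint D A \<longleftrightarrow> complex_subspace D \<and> closure D = UNIV \<and> linear_on D A \<and>
     adjoint_domain D A = D \<and> (\<forall>x\<in>D. \<forall>y\<in>D. cinner y (A x) = cinner (A y) x)"

definition orth_projection :: "('a::complex_inner \<Rightarrow> 'a) \<Rightarrow> bool" where
  "orth_projection P \<longleftrightarrow> linear_on UNIV P \<and> bounded_linear P \<and> (\<forall>x. P (P x) = P x) \<and>
     (\<forall>x y. cinner (P x) y = cinner x (P y))"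

definition resolvent :: "'a::complex_inner set \<Rightarrow> ('a \<Rightarrow> 'a) \<Rightarrow> complex \<Rightarrow> 'a \<Rightarrow> 'a" where
  "resolvent D A z chi = (THE u. u \<in> D \<and> A u - scaleC z u = chi)"

text \<open>Spectrum of the part of (D, A) in a (reducing) subspace S.\<close>
definition spectrum_on :: "'a::complex_inner set \<Rightarrow> 'a set \<Rightarrow> ('a \<Rightarrow> 'a) \<Rightarrow> complex set" where
  "spectrum_on S D A = {lam. \<not> ((\<forall>chi\<in>S. \<exists>!u. u \<in> D \<inter> S \<and> A u - scaleC lam u = chi) \<and>
       (\<exists>C. \<forall>u\<in>D \<inter> S. norm u \<le> C * norm (A u - scaleC lam u)))}"

text \<open>mu is the spectral measure of phi for the self-adjoint operator (D, A), characterised by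
  its Borel transform: cinner phi ((A - z)^{-1} phi) = integral of 1/(x - z) d mu(x).\<close>
definition is_spectral_measure :: "'a::complex_inner set \<Rightarrow> ('a \<Rightarrow> 'a) \<Rightarrow> 'a \<Rightarrow> real measure \<Rightarrow> bool" where
  "is_spectral_measure D A phi mu \<longleftrightarrow> sets mu = sets borel \<and> finite_measure mu \<and>
     (\<forall>z. Im z \<noteq> 0 \<longrightarrow> cinner phi (resolvent D A z phi) = (\<integral>x. 1 / (complex_of_real x - z) \<partial>mu))"

definition ac_subspace :: "'a::complex_inner set \<Rightarrow> ('a \<Rightarrow> 'a) \<Rightarrow> 'a set" where
  "ac_subspace D A = {phi. \<exists>mu. is_spectral_measure D A phi mu \<and> absolutely_continuous lborel mu}"

definition sigma_ac :: "'a::complex_inner set \<Rightarrow> ('a \<Rightarrow> 'a) \<Rightarrow> real set" where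
  "sigma_ac D A = {lam. complex_of_real lam \<in> spectrum_on (ac_subspace D A) D A}"

definition sigma_p :: "'a::complex_inner set \<Rightarrow> ('a \<Rightarrow> 'a) \<Rightarrow> real set" where
  "sigma_p D A = {lam. \<exists>phi\<in>D. phi \<noteq> 0 \<and> A phi = scaleC (complex_of_real lam) phi}"

definition rank_one_pert :: "('a::complex_inner \<Rightarrow> 'a) \<Rightarrow> real \<Rightarrow> 'a \<Rightarrow> 'a \<Rightarrow> 'a" where
  "rank_one_pert A kappa psi = (\<lambda>x. A x + scaleC (complex_of_real kappa * cinner psi x) psi)"

definition F0 :: "'a::complex_inner set \<Rightarrow> ('a \<Rightarrow> 'a) \<Rightarrow> ('a \<Rightarrow> 'a) \<Rightarrow> 'a \<Rightarrow> complex \<Rightarrow> complex" where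
  "F0 D A P psi z =
     (let Pp = (\<lambda>x. x - P x) in
      cinner psi (Pp (resolvent {x. Pp x \<in> D} (\<lambda>x. Pp (A (Pp x))) z (Pp psi))))"

end

(*
  For kappa <> 0 let F(z) and G(z) be the matrix elements of the resolvents of H_0 and H_kappa at psi.
  Since P reduces H_0, Im F >= Im F_0, and Krein's formula (1 - kappa G)(1 + kappa F) = 1 bounds G wherever
  Im F is bounded below.  By Baire, every subinterval of J contains an interval [a,b] on which
  Im F(x + i eps) >= 1/n for all eps < 1/n; there G is bounded, so the spectral measure of psi for H_kappa
  gives intervals mass O(length) and is absolutely continuous.  It does not vanish on (a,b): otherwise
  Im G(x + i0) = 0 and hence G(x + i0) = 1/kappa for every x in (a,b), whereas G is strictly increasing off
  its support.  A bump function of H_kappa, supported in (a,b) and applied to psi, is then an approximate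
  eigenvector in the absolutely continuous subspace.

  The spectral measure is that of the Cayley transform V: Herglotz' theorem for the moments <psi, V^k psi>
  (Fejer means and Helly's theorem) yields it on the circle, and Stone-Weierstrass gives the functional calculus.

  If H_kappa phi = x phi with x in J, then <psi, phi> <> 0 by (2), so psi is in the range of H_0 - x, which
  forces Im F_0(x + i0) = 0 against (1).
*)

theory Submission
  imports Defs
begin

section \<open>Complex inner product spaces\<close>

text \<open>The limit in (1) is only pointwise, so no uniform resolvent bound for
  \<open>H_kappa\<close> is available near a prescribed point \<open>l0\<close> of \<open>J\<close>.
  The spectrum tolerates this: \<open>l0\<close> is in \<open>sigma_ac\<close> as soon as every
  estimate \<open>norm u <= C * norm ((H - l0) u)\<close> fails on the absolutely continuous
  vectors. For one given \<open>C\<close>, a nonzero vector with spectral support in some interval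
  within \<open>1 / (|C| + 1)\<close> of \<open>l0\<close> violates it, even if that interval misses
  \<open>l0\<close>. Such an interval is what Baire delivers. The set \<open>ac_subspace\<close> is
  described by Borel transforms alone and \<open>psi\<close> is not assumed cyclic, so nothing is
  proved about the structure of that set: the single test vector is a function of
  \<open>H_kappa\<close> applied to \<open>psi\<close>, and its spectral measure is written down
  explicitly. On the circle, \<open>w = 1\<close> represents infinity on the line. A possible atom
  there is never excluded, only made harmless: the resolvent kernel and the bump function both
  vanish at \<open>w = 1\<close>.\<close>

lemma cinner_add_left: "cinner (x + y) z = cinner x z + cinner (y::'a::complex_inner) z"
  by (metis cinner_add_right cinner_conj complex_cnj_add)

lemma cinner_scaleC_left: "cinner (scaleC a x) y = cnj a * cinner (x::'a::complex_inner) y"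
  by (metis cinner_conj cinner_scaleC_right complex_cnj_mult)

lemma cinner_scaleR_right: "cinner x (scaleR r y) = r *\<^sub>R cinner x (y::'a::complex_inner)"
  by (metis cinner_scaleC_right scaleC_of_real scaleR_conv_of_real)

lemma cinner_scaleR_left: "cinner (scaleR r x) y = r *\<^sub>R cinner x (y::'a::complex_inner)"
  by (metis cinner_conj cinner_scaleR_right complex_cnj_scaleR)

lemma cinner_self: "cinner x x = of_real ((norm (x::'a::complex_inner))\<^sup>2)"
proof -
  have "Im (cinner x x) = 0"
    by (metis cinner_conj complex_cnj_cancel_iff complex_eq_iff cnj.simps(2) neg_equal_zero)
  moreover have "Re (cinner x x) = (norm x)\<^sup>2"
    using norm_eq_sqrt_cinner[of x] cinner_ge_zero[of x] by simp
  ultimately show ?thesis by (simp add: complex_eq_iff)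
qed

lemma scaleC_zero_left [simp]: "scaleC 0 (x::'a::complex_inner) = 0"
  using scaleC_of_real[of 0 x] by simp
lemma scaleC_one [simp]: "scaleC 1 (x::'a::complex_inner) = x"
  using scaleC_of_real[of 1 x] by simp
lemma scaleC_minus_one: "scaleC (- 1) (x::'a::complex_inner) = - x"
  using scaleC_of_real[of "-1" x] by simp
lemma scaleC_zero_right [simp]: "scaleC a (0::'a::complex_inner) = 0"
  by (metis add_cancel_left_left scaleC_add_right)
lemma scaleC_minus_left: "scaleC (- a) (x::'a::complex_inner) = - scaleC a x"
  by (metis mult_minus1 scaleC_minus_one scaleC_scaleC)
lemma scaleC_minus_right: "scaleC a (- x::'a::complex_inner) = - scaleC a x"
  by (metis mult.commute scaleC_minus_left scaleC_minus_one scaleC_scaleC mult_minus1)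
lemma scaleC_diff_left: "scaleC (a - b) (x::'a::complex_inner) = scaleC a x - scaleC b x"
  using scaleC_add_left[of a "-b" x] by (simp add: scaleC_minus_left)
lemma scaleC_diff_right: "scaleC a (x - y::'a::complex_inner) = scaleC a x - scaleC a y"
  using scaleC_add_right[of a x "-y"] by (simp add: scaleC_minus_right)

lemma cinner_zero_left [simp]: "cinner 0 (x::'a::complex_inner) = 0"
  by (metis add_cancel_left_left cinner_add_left)
lemma cinner_zero_right [simp]: "cinner (x::'a::complex_inner) 0 = 0"
  by (metis add_cancel_left_left cinner_add_right)
lemma cinner_minus_left: "cinner (- x) y = - cinner x (y::'a::complex_inner)"
  using cinner_scaleC_left[of "-1" x y] by (simp add: scaleC_minus_one)
lemma cinner_minus_right: "cinner x (- y) = - cinner x (y::'a::complex_inner)"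
  using cinner_scaleC_right[of x "-1" y] by (simp add: scaleC_minus_one)
lemma cinner_diff_left: "cinner (x - y) z = cinner x z - cinner (y::'a::complex_inner) z"
  using cinner_add_left[of x "-y" z] by (simp add: cinner_minus_left)
lemma cinner_diff_right: "cinner z (x - y) = cinner z x - cinner z (y::'a::complex_inner)"
  using cinner_add_right[of z x "-y"] by (simp add: cinner_minus_right)

lemma scaleC_double: "scaleC (2 * a) (x::'a::complex_inner) = scaleC a x + scaleC a x"
  by (metis mult_2 scaleC_add_left)

lemmas scaleC_simps = scaleC_add_left scaleC_add_right scaleC_diff_left scaleC_diff_right
  scaleC_minus_left scaleC_minus_right scaleC_scaleC
lemmas cinner_simps = cinner_add_left cinner_add_right cinner_diff_left cinner_diff_right
  cinner_minus_left cinner_minus_right cinner_scaleC_left cinner_scaleC_right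

lemma mult_cnj_eq_cmod: "a * cnj a = (complex_of_real (cmod a))\<^sup>2"
  using complex_norm_square[of a] by simp

lemma norm_scaleC [simp]: "norm (scaleC a x) = cmod a * norm (x::'a::complex_inner)"
proof -
  have "of_real ((norm (scaleC a x))\<^sup>2) = cnj a * a * of_real ((norm x)\<^sup>2)"
    unfolding cinner_self[symmetric] by (simp add: cinner_simps)
  also have "\<dots> = of_real ((cmod a * norm x)\<^sup>2)"
    by (simp add: mult_cnj_eq_cmod power_mult_distrib mult.commute)
  finally show ?thesis
    by (metis of_real_eq_iff mult_nonneg_nonneg norm_ge_zero power2_eq_iff_nonneg)
qed

text \<open>Pythagoras for the residual of \<open>y\<close> after projection onto the line through
  \<open>x\<close>. Nonnegativity of the left side is Cauchy-Schwarz; minimality of a distance turns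
  it into orthogonality.\<close>

lemma norm_diff_projection:
  fixes x y :: "'a::complex_inner"
  assumes "x \<noteq> 0"
  shows "(norm (y - scaleC (cinner x y / of_real ((norm x)\<^sup>2)) x))\<^sup>2
    = (norm y)\<^sup>2 - (cmod (cinner x y))\<^sup>2 / (norm x)\<^sup>2" (is "(norm (y - scaleC ?a x))\<^sup>2 = _")
proof -
  have n: "norm x \<noteq> 0" using assms by simp
  have "complex_of_real ((norm (y - scaleC ?a x))\<^sup>2) = cinner (y - scaleC ?a x) (y - scaleC ?a x)"
    by (simp only: cinner_self)
  also have "\<dots> = cinner y y - ?a * cinner y x - cnj ?a * cinner x y + cnj ?a * ?a * cinner x x"
    by (simp add: cinner_simps algebra_simps)
  also have "\<dots> = of_real ((norm y)\<^sup>2) - (cinner x y * cnj (cinner x y)) / of_real ((norm x)\<^sup>2)"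
    using n unfolding cinner_self cinner_conj[of y x]
    by (simp add: field_simps power2_eq_square)
  also have "\<dots> = of_real ((norm y)\<^sup>2 - (cmod (cinner x y))\<^sup>2 / (norm x)\<^sup>2)"
    by (simp add: mult_cnj_eq_cmod)
  finally show ?thesis by (simp only: of_real_eq_iff)
qed

lemma cinner_Cauchy_Schwarz: "cmod (cinner x y) \<le> norm x * norm (y::'a::complex_inner)"
proof (cases "x = 0")
  case False
  have "0 \<le> (norm y)\<^sup>2 - (cmod (cinner x y))\<^sup>2 / (norm x)\<^sup>2"
    unfolding norm_diff_projection[OF False, symmetric] by simp
  hence "(cmod (cinner x y))\<^sup>2 \<le> (norm x * norm y)\<^sup>2"
    using False by (simp add: field_simps power_mult_distrib)
  thus ?thesis by (rule power2_le_imp_le) simp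
qed simp

interpretation cinner: bounded_bilinear "cinner :: 'a::complex_inner \<Rightarrow> 'a \<Rightarrow> complex"
proof
  show "\<exists>K. \<forall>(a::'a) b. norm (cinner a b) \<le> norm a * norm b * K"
    by (rule exI[of _ 1]) (simp add: cinner_Cauchy_Schwarz)
qed (simp_all add: cinner_simps cinner_scaleR_left cinner_scaleR_right)

interpretation scaleC: bounded_bilinear "scaleC :: complex \<Rightarrow> 'a \<Rightarrow> 'a::complex_inner"
proof
  show "\<exists>K. \<forall>a (b::'a). norm (scaleC a b) \<le> norm a * norm b * K"
    by (rule exI[of _ 1]) simp
  show "scaleC (r *\<^sub>R a) b = r *\<^sub>R scaleC a b" for r a and b :: 'a
    by (metis scaleC_of_real scaleC_scaleC scaleR_conv_of_real)
  show "scaleC a (r *\<^sub>R b) = r *\<^sub>R scaleC a b" for r a and b :: 'a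
    by (metis scaleC_of_real scaleC_scaleC mult.commute)
qed (simp_all add: scaleC_simps)

lemma parallelogram:
  "(norm (x + y))\<^sup>2 + (norm (x - y))\<^sup>2 = 2 * (norm x)\<^sup>2 + 2 * (norm (y::'a::complex_inner))\<^sup>2"
proof -
  have "complex_of_real ((norm (x + y))\<^sup>2 + (norm (x - y))\<^sup>2) = of_real (2 * (norm x)\<^sup>2 + 2 * (norm y)\<^sup>2)"
    unfolding of_real_add of_real_mult cinner_self[symmetric] by (simp add: cinner_simps)
  thus ?thesis by (simp only: of_real_eq_iff)
qed

lemma complex_subspace_closed_under:
  assumes "complex_subspace S"
  shows "0 \<in> S" "x \<in> S \<Longrightarrow> y \<in> S \<Longrightarrow> x + y \<in> S" "x \<in> S \<Longrightarrow> scaleC a x \<in> S"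
    "x \<in> S \<Longrightarrow> y \<in> S \<Longrightarrow> x - y \<in> S"
proof -
  show d: "0 \<in> S" "x \<in> S \<Longrightarrow> y \<in> S \<Longrightarrow> x + y \<in> S" "x \<in> S \<Longrightarrow> scaleC a x \<in> S" for a x y
    using assms by (auto simp: complex_subspace_def)
  show "x - y \<in> S" if "x \<in> S" "y \<in> S"
    using d(2)[OF that(1) d(3)[OF that(2), of "-1"]] by (simp add: scaleC_minus_one)
qed

text \<open>A minimising sequence is Cauchy by the parallelogram law: the midpoint of two members is
  again in \<open>S\<close>, hence at distance at least \<open>d\<close> from \<open>x\<close>,
  which leaves little room for their difference.\<close>

lemma closed_subspace_nearest_point:
  fixes S :: "'a::{complex_inner, complete_space} set"
  assumes S: "complex_subspace S" and cl: "closed S"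
  shows "\<exists>s\<in>S. \<forall>t\<in>S. norm (x - s) \<le> norm (x - t)"
proof -
  define d where "d = (INF s\<in>S. norm (x - s))"
  note SS = complex_subspace_closed_under[OF S]
  have bdd: "bdd_below ((\<lambda>s. norm (x - s)) ` S)" by (rule bdd_belowI[of _ 0]) auto
  have ne: "S \<noteq> {}" using SS(1) by auto
  have dle: "d \<le> norm (x - s)" if "s \<in> S" for s
    unfolding d_def using bdd that by (rule cINF_lower)
  have d0: "0 \<le> d" unfolding d_def using ne by (rule cINF_greatest) simp
  have "\<exists>s\<in>S. norm (x - s) < d + 1 / real (Suc n)" for n
  proof -
    have "d < d + 1 / real (Suc n)" by simp
    thus ?thesis unfolding d_def by (rule cINF_less_iff[OF ne bdd, THEN iffD1])
  qed
  then obtain s where sS: "\<And>n. s n \<in> S" and sd: "\<And>n. norm (x - s n) < d + 1 / real (Suc n)"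
    by metis
  have lim: "(\<lambda>n. norm (x - s n)) \<longlonglongrightarrow> d"
  proof (rule tendsto_sandwich[of "\<lambda>_. d"])
    show "(\<lambda>n. d + 1 / real (Suc n)) \<longlonglongrightarrow> d"
      using tendsto_add[OF tendsto_const LIMSEQ_inverse_real_of_nat, of d] by (simp add: inverse_eq_divide)
  qed (use dle sS sd in \<open>auto intro!: always_eventually less_imp_le\<close>)
  have key: "(norm (s m - s n))\<^sup>2 \<le> 2 * (norm (x - s m))\<^sup>2 + 2 * (norm (x - s n))\<^sup>2 - 4 * d\<^sup>2" for m n
  proof -
    have mid: "scaleC (1/2) (s m + s n) \<in> S" using SS sS by blast
    have "(x - s m) + (x - s n) = scaleC 2 (x - scaleC (1/2) (s m + s n))"
      using scaleC_add_left[of 1 1 x] by (simp add: scaleC_simps)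
    hence "norm ((x - s m) + (x - s n)) = 2 * norm (x - scaleC (1/2) (s m + s n))" by simp
    hence "norm ((x - s m) + (x - s n)) \<ge> 2 * d" using dle[OF mid] by simp
    hence "(norm ((x - s m) + (x - s n)))\<^sup>2 \<ge> (2 * d)\<^sup>2" using d0 by (intro power_mono) auto
    moreover have "norm ((x - s m) - (x - s n)) = norm (s m - s n)"
      by (simp add: norm_minus_commute)
    ultimately show ?thesis using parallelogram[of "x - s m" "x - s n"] by (simp add: power_mult_distrib)
  qed
  have "Cauchy s"
  proof (rule metric_CauchyI)
    fix e :: real assume e: "0 < e"
    have "(\<lambda>n. (norm (x - s n))\<^sup>2) \<longlonglongrightarrow> d\<^sup>2" by (intro tendsto_intros lim)
    moreover have "d\<^sup>2 < d\<^sup>2 + e\<^sup>2 / 4" using e by simp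
    ultimately have "eventually (\<lambda>n. (norm (x - s n))\<^sup>2 < d\<^sup>2 + e\<^sup>2 / 4) sequentially"
      by (rule order_tendstoD(2))
    then obtain N where N: "\<And>n. n \<ge> N \<Longrightarrow> (norm (x - s n))\<^sup>2 < d\<^sup>2 + e\<^sup>2 / 4"
      by (auto simp: eventually_sequentially)
    show "\<exists>M. \<forall>m\<ge>M. \<forall>n\<ge>M. dist (s m) (s n) < e"
    proof (intro exI[of _ N] allI impI)
      fix m n assume "N \<le> m" "N \<le> n"
      hence "(norm (s m - s n))\<^sup>2 < e\<^sup>2" using key[of m n] N[of m] N[of n] by linarith
      thus "dist (s m) (s n) < e" unfolding dist_norm using e by (simp add: power2_less_imp_less)
    qed
  qed
  then obtain l where l: "s \<longlonglongrightarrow> l" using Cauchy_convergent convergent_def by blast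
  have "l \<in> S" using cl l sS closed_sequentially by blast
  moreover have "norm (x - l) = d"
    using LIMSEQ_unique[OF tendsto_norm[OF tendsto_diff[OF tendsto_const l]] lim] .
  ultimately show ?thesis using dle by auto
qed

text \<open>Take \<open>x\<close> outside \<open>S\<close> minus its nearest point. Were it not
  orthogonal to some \<open>t\<close> in \<open>S\<close>, moving the nearest point by the
  projection coefficient along \<open>t\<close> would shorten the distance.\<close>

lemma closed_subspace_orthogonal_vector:
  fixes S :: "'a::{complex_inner, complete_space} set"
  assumes S: "complex_subspace S" and cl: "closed S" and ne: "S \<noteq> UNIV"
  obtains y where "y \<noteq> 0" "\<And>s. s \<in> S \<Longrightarrow> cinner y s = 0"
proof -
  note SS = complex_subspace_closed_under[OF S]
  obtain x where x: "x \<notin> S" using ne by auto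
  obtain s where s: "s \<in> S" and min: "\<And>t. t \<in> S \<Longrightarrow> norm (x - s) \<le> norm (x - t)"
    using closed_subspace_nearest_point[OF S cl] by blast
  have "cinner (x - s) t = 0" if t: "t \<in> S" for t
  proof (cases "t = 0")
    case False
    let ?a = "cinner t (x - s) / of_real ((norm t)\<^sup>2)"
    have "s + scaleC ?a t \<in> S" using SS s t by blast
    from min[OF this] have "(norm (x - s))\<^sup>2 \<le> (norm (x - s - scaleC ?a t))\<^sup>2"
      by (intro power_mono) (auto simp: algebra_simps)
    also have "\<dots> = (norm (x - s))\<^sup>2 - (cmod (cinner t (x - s)))\<^sup>2 / (norm t)\<^sup>2"
      by (rule norm_diff_projection[OF False])
    finally have "(cmod (cinner t (x - s)))\<^sup>2 / (norm t)\<^sup>2 \<le> 0" by simp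
    hence "cinner t (x - s) = 0" using False by (simp add: divide_le_0_iff)
    thus ?thesis by (metis cinner_conj complex_cnj_zero)
  qed simp
  moreover have "x - s \<noteq> 0" using x s by auto
  ultimately show ?thesis using that by blast
qed

lemma dense_cinner_eq_zero:
  fixes v :: "'a::complex_inner"
  assumes cl: "closure D = UNIV" and z: "\<And>x. x \<in> D \<Longrightarrow> cinner v x = 0"
  shows "v = 0"
proof -
  have "v \<in> closure D" using cl by simp
  then obtain x where x: "\<And>n. x n \<in> D" "x \<longlonglongrightarrow> v" unfolding closure_sequential by blast
  have "(\<lambda>n. cinner v (x n)) \<longlonglongrightarrow> cinner v v" by (intro cinner.tendsto tendsto_const x)
  hence "cinner v v = 0" using z[OF x(1)] by (simp add: LIMSEQ_const_iff)
  thus ?thesis by (simp add: cinner_eq_zero_iff)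
qed

section \<open>Resolvent and Cayley transform of a self-adjoint operator\<close>

locale self_adjoint_op =
  fixes D :: "'a::{complex_inner, complete_space} set" and A :: "'a \<Rightarrow> 'a"
  assumes sa: "self_adjoint D A"
begin

lemma dom: "0 \<in> D" "x \<in> D \<Longrightarrow> y \<in> D \<Longrightarrow> x + y \<in> D" "x \<in> D \<Longrightarrow> scaleC a x \<in> D"
    "x \<in> D \<Longrightarrow> y \<in> D \<Longrightarrow> x - y \<in> D"
  using sa unfolding self_adjoint_def by (blast intro: complex_subspace_closed_under)+

lemma dense: "closure D = UNIV" using sa by (simp add: self_adjoint_def)

lemma op_add: "x \<in> D \<Longrightarrow> y \<in> D \<Longrightarrow> A (x + y) = A x + A y"
  and op_scaleC: "x \<in> D \<Longrightarrow> A (scaleC a x) = scaleC a (A x)"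
  using sa by (auto simp: self_adjoint_def linear_on_def)

lemma op_diff: "x \<in> D \<Longrightarrow> y \<in> D \<Longrightarrow> A (x - y) = A x - A y"
  using op_add[of x "scaleC (-1) y"] op_scaleC[of y "-1"] dom(3)[of y "-1"] by (simp add: scaleC_minus_one)

lemma symm: "x \<in> D \<Longrightarrow> y \<in> D \<Longrightarrow> cinner y (A x) = cinner (A y) x"
  using sa by (auto simp: self_adjoint_def)

text \<open>This is where \<open>adjoint_domain D A = D\<close> enters: an equation tested only
  against \<open>D\<close> yields both membership in the domain and the value. Closedness of
  \<open>A\<close>, triviality of the deficiency spaces and stability under the perturbation all
  rest on it.\<close>

lemma adjointI:
  assumes "\<And>x. x \<in> D \<Longrightarrow> cinner y (A x) = cinner w x"
  shows "y \<in> D \<and> A y = w"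
proof -
  have "y \<in> adjoint_domain D A" using assms by (auto simp: adjoint_domain_def)
  hence y: "y \<in> D" using sa by (simp add: self_adjoint_def)
  have "A y - w = 0"
    by (rule dense_cinner_eq_zero[OF dense]) (use y assms symm in \<open>auto simp: cinner_simps\<close>)
  thus ?thesis using y by simp
qed

text \<open>By symmetry \<open>cinner u (A u)\<close> is real, so only the shift contributes an
  imaginary part.\<close>

lemma Im_cinner_shift:
  assumes "u \<in> D"
  shows "Im (cinner u (A u - scaleC z u)) = - Im z * (norm u)\<^sup>2"
proof -
  have "Im (cinner u (A u)) = 0"
    using arg_cong[OF cinner_conj[of u "A u"], of Im] by (simp add: symm[OF assms assms])
  thus ?thesis by (simp add: cinner_simps cinner_self flip: of_real_power)
qed

lemma shift_bound:
  assumes "u \<in> D"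
  shows "\<bar>Im z\<bar> * norm u \<le> norm (A u - scaleC z u)"
proof (cases "u = 0")
  case False
  have "\<bar>Im z\<bar> * (norm u)\<^sup>2 = \<bar>Im (cinner u (A u - scaleC z u))\<bar>"
    by (simp add: Im_cinner_shift[OF assms] abs_mult)
  also have "\<dots> \<le> cmod (cinner u (A u - scaleC z u))" by (rule abs_Im_le_cmod)
  also have "\<dots> \<le> norm u * norm (A u - scaleC z u)" by (rule cinner_Cauchy_Schwarz)
  finally have "norm u * (\<bar>Im z\<bar> * norm u) \<le> norm u * norm (A u - scaleC z u)"
    by (simp add: power2_eq_square algebra_simps)
  thus ?thesis using False by (simp add: mult_le_cancel_left_pos)
qed simp

lemma shift_inj:
  assumes "Im z \<noteq> 0" "u \<in> D" "v \<in> D" "A u - scaleC z u = A v - scaleC z v"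
  shows "u = v"
proof -
  have "A (u - v) - scaleC z (u - v) = 0"
    using assms by (simp add: op_diff scaleC_simps algebra_simps)
  hence "\<bar>Im z\<bar> * norm (u - v) \<le> 0" by (metis shift_bound[OF dom(4)[OF assms(2,3)]] norm_zero)
  thus ?thesis using assms(1) by (simp add: mult_le_0_iff)
qed

text \<open>The range is closed because \<open>shift_bound\<close> transfers Cauchy sequences back
  to the domain. A vector orthogonal to the range would be an eigenvector of \<open>A\<close> for
  \<open>cnj z\<close>, which \<open>shift_inj\<close> forbids.\<close>

lemma shift_surj:
  assumes z: "Im z \<noteq> 0"
  shows "\<exists>u\<in>D. A u - scaleC z u = chi"
proof (rule ccontr)
  define S where "S = (\<lambda>u. A u - scaleC z u) ` D"
  assume "\<not> ?thesis"
  hence "chi \<notin> S" by (auto simp: S_def)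
  hence ne: "S \<noteq> UNIV" by blast
  have sub: "complex_subspace S"
    unfolding complex_subspace_def
  proof (intro conjI ballI allI)
    show "0 \<in> S" unfolding S_def using dom(1) op_diff[of 0 0] by (auto intro!: image_eqI[of _ _ 0])
    fix x assume "x \<in> S"
    then obtain u where u: "u \<in> D" "x = A u - scaleC z u" by (auto simp: S_def)
    show "scaleC a x \<in> S" for a
      unfolding S_def u(2) by (rule image_eqI[of _ _ "scaleC a u"])
        (auto simp: u dom op_scaleC scaleC_simps mult.commute)
    fix y assume "y \<in> S"
    then obtain v where v: "v \<in> D" "y = A v - scaleC z v" by (auto simp: S_def)
    show "x + y \<in> S" unfolding S_def u(2) v(2)
      by (rule image_eqI[of _ _ "u + v"]) (auto simp: u v dom op_add scaleC_simps)
  qed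
  have "closed S"
    unfolding closed_sequential_limits
  proof (intro allI impI, elim conjE)
    fix y l assume y: "\<forall>n. y n \<in> S" and l: "y \<longlonglongrightarrow> l"
    have "\<forall>n. \<exists>v. v \<in> D \<and> y n = A v - scaleC z v"
      using y by (auto simp: S_def image_iff Bex_def)
    then obtain u where u: "\<And>n. u n \<in> D" "\<And>n. y n = A (u n) - scaleC z (u n)"
      by metis
    have bd: "\<bar>Im z\<bar> * norm (u m - u n) \<le> norm (y m - y n)" for m n
      using shift_bound[OF dom(4)[OF u(1)[of m] u(1)[of n]], of z]
      by (simp add: u op_diff scaleC_simps algebra_simps)
    have "Cauchy u"
    proof (rule metric_CauchyI)
      fix e :: real assume e: "0 < e"
      hence "0 < e * \<bar>Im z\<bar>" using z by simp
      then obtain M where M: "\<And>m n. m \<ge> M \<Longrightarrow> n \<ge> M \<Longrightarrow> dist (y m) (y n) < e * \<bar>Im z\<bar>"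
        using metric_CauchyD[OF LIMSEQ_imp_Cauchy[OF l]] by meson
      show "\<exists>M. \<forall>m\<ge>M. \<forall>n\<ge>M. dist (u m) (u n) < e"
      proof (intro exI[of _ M] allI impI)
        fix m n assume "M \<le> m" "M \<le> n"
        hence "norm (u m - u n) * \<bar>Im z\<bar> < e * \<bar>Im z\<bar>"
          using bd[of m n] M[of m n] by (simp add: dist_norm mult.commute)
        thus "dist (u m) (u n) < e" using z by (simp add: dist_norm)
      qed
    qed
    then obtain v where v: "u \<longlonglongrightarrow> v" using Cauchy_convergent convergent_def by blast
    \<comment> \<open>Closedness of \<open>A\<close>: the limit is taken in the weak form of the
      equation, and \<open>adjointI\<close> turns it back into a statement about the domain.\<close>
    have "v \<in> D \<and> A v = l + scaleC z v"
    proof (rule adjointI)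
      fix x assume x: "x \<in> D"
      have "(\<lambda>n. cinner (u n) (A x)) \<longlonglongrightarrow> cinner v (A x)"
        by (intro cinner.tendsto v tendsto_const)
      moreover have "(\<lambda>n. cinner (y n + scaleC z (u n)) x) \<longlonglongrightarrow> cinner (l + scaleC z v) x"
        by (intro cinner.tendsto scaleC.tendsto tendsto_add l v tendsto_const)
      moreover have "cinner (u n) (A x) = cinner (y n + scaleC z (u n)) x" for n
        using symm[OF x u(1)] by (simp add: u)
      ultimately show "cinner v (A x) = cinner (l + scaleC z v) x" using LIMSEQ_unique by simp
    qed
    thus "l \<in> S" unfolding S_def by (auto intro!: image_eqI[of _ _ v])
  qed
  then obtain y where y0: "y \<noteq> 0" and y: "\<And>s. s \<in> S \<Longrightarrow> cinner y s = 0"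
    using closed_subspace_orthogonal_vector[OF sub _ ne] by blast
  have "y \<in> D \<and> A y = scaleC (cnj z) y"
  proof (rule adjointI)
    fix x assume "x \<in> D"
    hence "cinner y (A x - scaleC z x) = 0" by (intro y) (simp add: S_def)
    thus "cinner y (A x) = cinner (scaleC (cnj z) y) x" by (simp add: cinner_simps)
  qed
  hence "y = 0" using op_diff[of 0 0] by (intro shift_inj[of "cnj z" y 0]) (use z dom(1) in auto)
  with y0 show False by simp
qed

abbreviation R :: "complex \<Rightarrow> 'a \<Rightarrow> 'a" where "R \<equiv> resolvent D A"

lemma resolvent_eqI:
  assumes "Im z \<noteq> 0" "u \<in> D" "A u - scaleC z u = chi"
  shows "R z chi = u"
  unfolding resolvent_def
proof (rule the_equality)
  show "u \<in> D \<and> A u - scaleC z u = chi" using assms by simp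
  show "v = u" if "v \<in> D \<and> A v - scaleC z v = chi" for v
    by (rule shift_inj[OF assms(1)]) (simp_all add: that assms)
qed

lemma
  assumes "Im z \<noteq> 0"
  shows resolvent_dom: "R z chi \<in> D"
    and shift_resolvent: "A (R z chi) - scaleC z (R z chi) = chi"
proof -
  obtain u where u: "u \<in> D" "A u - scaleC z u = chi" using shift_surj[OF assms] by blast
  show "R z chi \<in> D" "A (R z chi) - scaleC z (R z chi) = chi"
    unfolding resolvent_eqI[OF assms u] by (fact u)+
qed

lemma op_resolvent: "Im z \<noteq> 0 \<Longrightarrow> A (R z chi) = chi + scaleC z (R z chi)"
  using shift_resolvent[of z chi] by (simp add: algebra_simps)

lemma resolvent_add: "Im z \<noteq> 0 \<Longrightarrow> R z (x + y) = R z x + R z y"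
  by (rule resolvent_eqI) (auto simp: dom resolvent_dom op_add op_resolvent scaleC_simps)

lemma resolvent_scaleC: "Im z \<noteq> 0 \<Longrightarrow> R z (scaleC a x) = scaleC a (R z x)"
  by (rule resolvent_eqI) (auto simp: dom resolvent_dom op_scaleC op_resolvent scaleC_simps mult.commute)

lemma resolvent_diff: "Im z \<noteq> 0 \<Longrightarrow> R z (x - y) = R z x - R z y"
  by (rule resolvent_eqI) (auto simp: dom resolvent_dom op_diff op_resolvent scaleC_simps)

lemma norm_resolvent: "Im z \<noteq> 0 \<Longrightarrow> \<bar>Im z\<bar> * norm (R z x) \<le> norm x"
  using shift_bound[OF resolvent_dom, of z z x] by (simp add: shift_resolvent)

lemma resolvent_identity:
  assumes "Im z \<noteq> 0" "Im w \<noteq> 0"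
  shows "R z x - R w x = scaleC (z - w) (R z (R w x))"
proof -
  have "R z x = R w x + scaleC (z - w) (R z (R w x))"
    by (rule resolvent_eqI)
      (use assms in \<open>auto simp: dom resolvent_dom op_add op_diff op_scaleC op_resolvent scaleC_simps algebra_simps\<close>)
  thus ?thesis by simp
qed

text \<open>Turns imaginary parts of resolvent matrix elements into norms, so that comparing
  \<open>F_0\<close> with \<open>F\<close> becomes the fact that a projection shrinks norms.\<close>

lemma Im_cinner_resolvent:
  assumes "Im z \<noteq> 0"
  shows "Im (cinner x (R z x)) = Im z * (norm (R z x))\<^sup>2"
proof -
  have "Im (cinner (R z x) x) = - Im z * (norm (R z x))\<^sup>2"
    using Im_cinner_shift[OF resolvent_dom[OF assms, of x], of z] by (simp add: shift_resolvent assms)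
  thus ?thesis by (subst cinner_conj) simp
qed

text \<open>The added term is everywhere defined and symmetric, so it can be moved across the inner
  product; a weak equation for the perturbed operator is one for \<open>A\<close> with a modified
  right-hand side.\<close>

lemma self_adjoint_rank_one_pert: "self_adjoint D (rank_one_pert A kappa psi)"
  unfolding self_adjoint_def
proof (intro conjI ballI)
  show "complex_subspace D" using sa by (simp add: self_adjoint_def)
  show "closure D = UNIV" by (rule dense)
  show "linear_on D (rank_one_pert A kappa psi)"
    by (auto simp: linear_on_def rank_one_pert_def op_add op_scaleC cinner_simps scaleC_simps algebra_simps)
  have pert: "cinner y (rank_one_pert A kappa psi x)
      = cinner y (A x) + cinner (scaleC (of_real kappa * cinner psi y) psi) x" for x y
    by (simp add: rank_one_pert_def cinner_simps cinner_conj[of y psi])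
  show "cinner y (rank_one_pert A kappa psi x) = cinner (rank_one_pert A kappa psi y) x"
    if "x \<in> D" "y \<in> D" for x y
    using that unfolding pert by (simp add: rank_one_pert_def cinner_simps symm)
  show "adjoint_domain D (rank_one_pert A kappa psi) = D"
  proof
    show "D \<subseteq> adjoint_domain D (rank_one_pert A kappa psi)"
    proof
      fix y assume y: "y \<in> D"
      show "y \<in> adjoint_domain D (rank_one_pert A kappa psi)"
        unfolding adjoint_domain_def mem_Collect_eq pert
        by (rule exI[of _ "A y + scaleC (of_real kappa * cinner psi y) psi"])
          (auto simp: cinner_add_left symm y)
    qed
    show "adjoint_domain D (rank_one_pert A kappa psi) \<subseteq> D"
    proof
      fix y assume "y \<in> adjoint_domain D (rank_one_pert A kappa psi)"
      then obtain w where w: "\<And>x. x \<in> D \<Longrightarrow> cinner y (rank_one_pert A kappa psi x) = cinner w x"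
        by (auto simp: adjoint_domain_def)
      have "y \<in> D \<and> A y = w - scaleC (of_real kappa * cinner psi y) psi"
        by (rule adjointI) (use w pert in \<open>auto simp: cinner_diff_left algebra_simps\<close>)
      thus "y \<in> D" ..
    qed
  qed
qed

text \<open>The Cayley transform \<open>(A - i) (A + i)^(-1)\<close>, rewritten as
  \<open>1 - 2 i (A + i)^(-1)\<close> so that it is visibly defined everywhere; \<open>W\<close> is
  its inverse \<open>(A + i) (A - i)^(-1)\<close>.\<close>

definition V :: "'a \<Rightarrow> 'a" where "V x = x - scaleC (2 * \<i>) (R (-\<i>) x)"
definition W :: "'a \<Rightarrow> 'a" where "W x = x + scaleC (2 * \<i>) (R \<i> x)"

lemma V_add: "V (x + y) = V x + V y" and V_scaleC: "V (scaleC a x) = scaleC a (V x)"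
  by (simp_all add: V_def resolvent_add resolvent_scaleC scaleC_simps mult.commute algebra_simps)

lemma W_add: "W (x + y) = W x + W y" and W_scaleC: "W (scaleC a x) = scaleC a (W x)"
  by (simp_all add: W_def resolvent_add resolvent_scaleC scaleC_simps mult.commute algebra_simps)

lemma V_W: "V (W x) = x"
proof -
  have "R (-\<i>) (W x) = R \<i> x"
    by (rule resolvent_eqI) (simp_all add: resolvent_dom op_resolvent W_def scaleC_double scaleC_minus_left)
  thus ?thesis by (simp add: V_def) (simp add: W_def)
qed

lemma W_V: "W (V x) = x"
proof -
  have "R \<i> (V x) = R (-\<i>) x"
    by (rule resolvent_eqI) (simp_all add: resolvent_dom op_resolvent V_def scaleC_double scaleC_minus_left)
  thus ?thesis by (simp add: W_def) (simp add: V_def)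
qed

text \<open>With \<open>x = (A + i) u\<close> and \<open>V x = (A - i) u\<close>, and likewise for
  \<open>y\<close> and \<open>v\<close>, the two inner products differ only in the cross terms,
  which cancel by symmetry of \<open>A\<close>.\<close>

lemma cinner_V_V: "cinner (V x) (V y) = cinner x y"
proof -
  define u v where "u = R (-\<i>) x" and "v = R (-\<i>) y"
  have uv: "u \<in> D" "v \<in> D" by (simp_all add: u_def v_def resolvent_dom)
  have x: "x = A u + scaleC \<i> u" and y: "y = A v + scaleC \<i> v"
    unfolding u_def v_def by (simp_all add: op_resolvent scaleC_simps)
  have "V x = A u - scaleC \<i> u" "V y = A v - scaleC \<i> v"
    unfolding V_def u_def[symmetric] v_def[symmetric] scaleC_double by (simp_all add: x y)
  hence "cinner (V x) (V y) = cinner (A u - scaleC \<i> u) (A v - scaleC \<i> v)" by simp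
  also have "\<dots> = cinner (A u + scaleC \<i> u) (A v + scaleC \<i> v)"
    using symm[OF uv(1,2)] symm[OF uv(2,1)] by (simp add: cinner_simps algebra_simps)
  finally show ?thesis by (simp flip: x y)
qed

end

locale unitary_pair =
  fixes V W :: "'a::{complex_inner, complete_space} \<Rightarrow> 'a"
  assumes V_add: "V (x + y) = V x + V y" and V_scaleC: "V (scaleC a x) = scaleC a (V x)"
    and W_add: "W (x + y) = W x + W y" and W_scaleC: "W (scaleC a x) = scaleC a (W x)"
    and V_W: "V (W x) = x" and W_V: "W (V x) = x" and cinner_V_V: "cinner (V x) (V y) = cinner x y"

sublocale self_adjoint_op \<subseteq> unitary_pair V W
  by unfold_locales (fact V_add V_scaleC W_add W_scaleC V_W W_V cinner_V_V)+

section \<open>The spectral measure of a unitary operator\<close>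

lemma has_bochner_integral_cis:
  fixes m :: int
  shows "has_bochner_integral lborel (\<lambda>t. indicator {0..2*pi} t *\<^sub>R cis (of_int m * t))
    (if m = 0 then 2 * of_real pi else 0)"
proof -
  define F where "F t = (if m = 0 then of_real t else cis (of_int m * t) / (\<i> * of_int m))" for t :: real
  have "has_bochner_integral lborel (\<lambda>t. indicator {0..2*pi} t *\<^sub>R cis (of_int m * t)) (F (2*pi) - F 0)"
  proof (rule has_bochner_integral_FTC_Icc)
    show "(F has_vector_derivative cis (of_int m * x)) (at x within {0..2*pi})" for x
    proof (cases "m = 0")
      case True
      thus ?thesis unfolding F_def by (auto intro!: derivative_eq_intros)
    next
      case False
      have "((\<lambda>t. exp (\<i> * of_int m * of_real t) / (\<i> * of_int m)) has_vector_derivative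
          exp (\<i> * of_int m * of_real x)) (at x within {0..2*pi})"
        using False
        by (intro has_vector_derivative_real_field) (auto intro!: derivative_eq_intros)
      thus ?thesis using False unfolding F_def cis_conv_exp by (simp add: mult.assoc)
    qed
    show "continuous_on {0..2*pi} (\<lambda>t. cis (of_int m * t))" by (intro continuous_intros)
  qed simp
  moreover have "F (2*pi) - F 0 = (if m = 0 then 2 * of_real pi else 0)"
    using cis_multiple_2pi[of "of_int m"] by (simp add: F_def mult.commute mult.left_commute)
  ultimately show ?thesis by simp
qed

context unitary_pair begin

lemma cinner_funpow: "cinner ((V ^^ j) x) ((V ^^ (j + n)) x) = cinner x ((V ^^ n) x)"
  by (induction j) (simp_all add: cinner_V_V)

text \<open>The \<open>V\<close>-analogue of the Fejer kernel: a nonnegative density on \<open>{0..2*pi}\<close> whose \<open>n\<close>-th moment is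
  \<open>(1 - n/N) * cinner x (V^n x)\<close>, so that any weak limit represents all moments at once.\<close>

definition fejer :: "'a \<Rightarrow> nat \<Rightarrow> real \<Rightarrow> real" where
  "fejer x N t = indicator {0..2*pi} t *
     ((norm (\<Sum>k<N. scaleC (cis (- (real k * t))) ((V ^^ k) x)))\<^sup>2 / (2 * pi * real N))"

lemma fejer_nonneg: "0 \<le> fejer x N t"
  by (simp add: fejer_def)

lemma fejer_measurable [measurable]: "fejer x N \<in> borel_measurable borel"
  unfolding fejer_def
  by (intro borel_measurable_times borel_measurable_divide borel_measurable_continuous_onI
      borel_measurable_indicator continuous_intros scaleC.continuous_on) auto

lemma fejer_expand:
  "complex_of_real (fejer x N t) =
    indicator {0..2*pi} t * (\<Sum>j<N. \<Sum>k<N. cis ((real j - real k) * t) * cinner ((V ^^ j) x) ((V ^^ k) x))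
      / (2 * pi * real N)"
proof -
  have "of_real ((norm (\<Sum>k<N. scaleC (cis (- (real k * t))) ((V ^^ k) x)))\<^sup>2)
      = (\<Sum>j<N. \<Sum>k<N. cis ((real j - real k) * t) * cinner ((V ^^ j) x) ((V ^^ k) x))"
    unfolding cinner_self[symmetric]
    by (subst cinner.sum_left, subst cinner.sum_right)
      (auto intro!: sum.cong simp: cinner_simps cis_cnj cis_mult algebra_simps simp flip: mult.assoc)
  thus ?thesis by (simp add: fejer_def indicator_def)
qed

text \<open>Integration over a period keeps only the pairs with \<open>k = j + n\<close>. There are
  \<open>N - n\<close> of them, each contributing the same value since \<open>V\<close> is
  isometric; this is the origin of the factor \<open>1 - n/N\<close>.\<close>

lemma fejer_moment:
  assumes nN: "n \<le> N" and N: "0 < N"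
  shows "has_bochner_integral lborel (\<lambda>t. fejer x N t *\<^sub>R cis (real n * t))
    ((1 - real n / real N) * cinner x ((V ^^ n) x))"
proof -
  let ?c = "\<lambda>j k. cinner ((V ^^ j) x) ((V ^^ k) x)"
  let ?I = "\<lambda>m::int. if m = 0 then 2 * of_real pi else (0::complex)"
  have "has_bochner_integral lborel (\<lambda>t. (\<Sum>j<N. \<Sum>k<N.
        (indicator {0..2*pi} t *\<^sub>R cis (of_int (int j - int k + int n) * t)) * ?c j k) / (2 * pi * real N))
      ((\<Sum>j<N. \<Sum>k<N. ?I (int j - int k + int n) * ?c j k) / (2 * pi * real N))"
    by (intro has_bochner_integral_divide has_bochner_integral_sum has_bochner_integral_mult_left
        has_bochner_integral_cis) 
  also have "(\<lambda>t. (\<Sum>j<N. \<Sum>k<N. (indicator {0..2*pi} t *\<^sub>R cis (of_int (int j - int k + int n) * t)) * ?c j k)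
        / (2 * pi * real N)) = (\<lambda>t. fejer x N t *\<^sub>R cis (real n * t))"
  proof
    fix t
    have "cis (of_int (int j - int k + int n) * t) = cis ((real j - real k) * t) * cis (real n * t)" for j k
      by (simp add: cis_mult algebra_simps)
    thus "(\<Sum>j<N. \<Sum>k<N. (indicator {0..2*pi} t *\<^sub>R cis (of_int (int j - int k + int n) * t)) * ?c j k)
        / (2 * pi * real N) = fejer x N t *\<^sub>R cis (real n * t)"
      unfolding scaleR_conv_of_real fejer_expand
      by (cases "t \<in> {0..2*pi}") (simp_all add: sum_distrib_left sum_distrib_right mult_ac)
  qed
  also have "(\<Sum>j<N. \<Sum>k<N. ?I (int j - int k + int n) * ?c j k)
      = (\<Sum>j<N. if j + n < N then 2 * of_real pi * cinner x ((V ^^ n) x) else 0)"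
  proof (rule sum.cong[OF refl])
    fix j assume "j \<in> {..<N}"
    have "(\<Sum>k<N. ?I (int j - int k + int n) * ?c j k) = (\<Sum>k<N. if k = j + n then 2 * of_real pi * ?c j k else 0)"
      by (intro sum.cong refl) auto
    also have "\<dots> = (if j + n < N then 2 * of_real pi * cinner x ((V ^^ n) x) else 0)"
      by (simp add: sum.delta cinner_funpow)
    finally show "(\<Sum>k<N. ?I (int j - int k + int n) * ?c j k)
      = (if j + n < N then 2 * of_real pi * cinner x ((V ^^ n) x) else 0)" .
  qed
  also have "\<dots> = (\<Sum>j<N - n. 2 * of_real pi * cinner x ((V ^^ n) x))"
    using nN by (intro sum.mono_neutral_cong_right) auto
  also have "\<dots> / (2 * pi * real N) = (1 - real n / real N) * cinner x ((V ^^ n) x)"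
    using nN N by (simp add: of_nat_diff field_simps)
  finally show ?thesis .
qed

text \<open>The Fejer densities are probability densities on a fixed bounded interval, hence tight.
  The moments are values of the characteristic function at integers, so they pass to a weak limit
  along a subsequence, where the Fejer factor tends to 1.\<close>

lemma herglotz:
  assumes psi: "norm psi = 1"
  obtains M where "real_distribution M" "\<And>k::nat. cinner psi ((V ^^ k) psi) = (\<integral>t. cis (real k * t) \<partial>M)"
proof -
  define M where "M N = density lborel (\<lambda>t. ennreal (fejer psi (Suc N) t))" for N
  have int: "has_bochner_integral lborel (fejer psi (Suc N)) 1" for N
  proof -
    have "has_bochner_integral lborel (\<lambda>t. Re (fejer psi (Suc N) t *\<^sub>R cis (real 0 * t)))
      (Re ((1 - real 0 / real (Suc N)) * cinner psi ((V ^^ 0) psi)))"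
      by (intro has_bochner_integral_Re fejer_moment) auto
    thus ?thesis by (simp add: cinner_self psi)
  qed
  have emM: "emeasure (M N) A = (\<integral>\<^sup>+t. ennreal (fejer psi (Suc N) t) * indicator A t \<partial>lborel)"
    if "A \<in> sets borel" for N A
    unfolding M_def using that by (intro emeasure_density) auto
  have tot: "(\<integral>\<^sup>+t. ennreal (fejer psi (Suc N) t) \<partial>lborel) = 1" for N
    using int[of N] nn_integral_eq_integral[of lborel "fejer psi (Suc N)"]
    by (simp add: has_bochner_integral_iff fejer_nonneg)
  have rd: "real_distribution (M N)" for N
  proof (intro real_distribution.intro prob_spaceI real_distribution_axioms.intro)
    show "emeasure (M N) (space (M N)) = 1" using emM[of UNIV N] tot[of N] by (simp add: M_def)
  qed (simp_all add: M_def)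
  \<comment> \<open>Tightness is phrased with half-open intervals; the left end lies below 0 so that
    all of \<open>{0..2*pi}\<close> is contained.\<close>
  have full: "measure (M N) {-1<..2*pi} = 1" for N
  proof -
    have "emeasure (M N) {-1<..2*pi} = (\<integral>\<^sup>+t. ennreal (fejer psi (Suc N) t) \<partial>lborel)"
      unfolding emM[of "{-1<..2*pi}", simplified]
      by (intro nn_integral_cong) (auto simp: fejer_def indicator_def)
    thus ?thesis by (simp add: tot measure_def)
  qed
  have "tight M"
    unfolding tight_def
  proof (intro conjI allI impI rd)
    fix e :: real assume "0 < e"
    hence "\<forall>n. 1 - e < measure (M n) {-1<..2*pi}" by (simp add: full)
    moreover have "-1 < 2 * pi" using pi_gt_zero by linarith
    ultimately show "\<exists>a b. a < b \<and> (\<forall>n. 1 - e < measure (M n) {a<..b})" by blast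
  qed
  from tight_imp_convergent_subsubsequence[OF this strict_mono_id]
  obtain r M' where r: "strict_mono r" and M': "real_distribution M'" and wk: "weak_conv_m (M \<circ> r) M'"
    by (auto simp: comp_assoc)
  have "cinner psi ((V ^^ k) psi) = (\<integral>t. cis (real k * t) \<partial>M')" for k
  proof -
    have ch: "char (M N) (real k) = (1 - real k / real (Suc N)) * cinner psi ((V ^^ k) psi)" if "k \<le> N" for N
    proof -
      have "char (M N) (real k) = (\<integral>t. fejer psi (Suc N) t *\<^sub>R cis (real k * t) \<partial>lborel)"
        unfolding char_def M_def by (subst integral_density) (auto simp: fejer_nonneg cis_conv_exp)
      also have "\<dots> = (1 - real k / real (Suc N)) * cinner psi ((V ^^ k) psi)"
        by (rule has_bochner_integral_integral_eq, rule fejer_moment) (use that in auto)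
      finally show ?thesis .
    qed
    have "(\<lambda>N. char ((M \<circ> r) N) (real k)) \<longlonglongrightarrow> char M' (real k)"
      by (rule levy_continuity1[OF _ M' wk]) (simp add: rd)
    moreover have "(\<lambda>N. char ((M \<circ> r) N) (real k)) \<longlonglongrightarrow> (1 - 0) * cinner psi ((V ^^ k) psi)"
    proof (rule Lim_transform_eventually)
      have "(\<lambda>N. real k / real (Suc N)) \<longlonglongrightarrow> 0"
        using tendsto_mult_right_zero[OF LIMSEQ_inverse_real_of_nat, of "real k"] by (simp add: divide_inverse)
      hence "(\<lambda>N. real k / real (Suc (r N))) \<longlonglongrightarrow> 0"
        using LIMSEQ_subseq_LIMSEQ[OF _ r] by (fastforce simp: o_def)
      hence "(\<lambda>N. complex_of_real (real k / real (Suc (r N)))) \<longlonglongrightarrow> of_real 0" by (rule tendsto_of_real)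
      thus "(\<lambda>N. (1 - complex_of_real (real k / real (Suc (r N)))) * cinner psi ((V ^^ k) psi))
          \<longlonglongrightarrow> (1 - 0) * cinner psi ((V ^^ k) psi)"
        by (intro tendsto_mult tendsto_diff tendsto_const) simp
      show "\<forall>\<^sub>F N in sequentially. (1 - complex_of_real (real k / real (Suc (r N)))) * cinner psi ((V ^^ k) psi)
          = char ((M \<circ> r) N) (real k)"
        using eventually_ge_at_top[of k]
      proof eventually_elim
        case (elim N)
        hence "k \<le> r N" using strict_mono_imp_increasing[OF r] seq_suble[OF r, of N] by linarith
        from ch[OF this] show ?case by simp
      qed
    qed
    ultimately have "char M' (real k) = cinner psi ((V ^^ k) psi)"
      using LIMSEQ_unique by fastforce
    thus ?thesis by (simp add: char_def cis_conv_exp)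
  qed
  with M' show ?thesis using that by blast
qed

lemma V_diff: "V (x - y) = V x - V y"
  using V_add[of x "scaleC (-1) y"] unfolding V_scaleC by (simp add: scaleC_minus_one)

lemma norm_V: "norm (V x) = norm x"
  by (simp add: norm_eq_sqrt_cinner cinner_V_V)

lemma cinner_V_right: "cinner x (V y) = cinner (W x) y"
  using cinner_V_V[of "W x" y] by (simp add: V_W)

lemma cinner_V_left: "cinner (V x) y = cinner x (W y)"
  using cinner_V_V[of x "W y"] by (simp add: V_W)

definition zpow :: "int \<Rightarrow> 'a \<Rightarrow> 'a" where
  "zpow k = (if 0 \<le> k then V ^^ nat k else W ^^ nat (- k))"

lemma V_zpow: "V (zpow k x) = zpow (k + 1) x"
proof (cases "0 \<le> k")
  case True
  thus ?thesis by (simp add: zpow_def nat_add_distrib)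
next
  case False
  hence "nat (- k) = Suc (nat (- (k + 1)))" by simp
  thus ?thesis using False by (auto simp: zpow_def V_W)
qed

lemma W_zpow: "W (zpow k x) = zpow (k - 1) x"
  by (metis V_zpow W_V diff_add_cancel)

lemma cinner_zpow: "cinner (zpow k x) x = cinner x (zpow (- k) x)"
proof -
  have V: "cinner ((V ^^ n) y) z = cinner y ((W ^^ n) z)" for n y z
    by (induction n arbitrary: y z) (simp_all add: cinner_V_left funpow_swap1)
  have W: "cinner ((W ^^ n) y) z = cinner y ((V ^^ n) z)" for n y z
    by (induction n arbitrary: y z) (simp_all add: cinner_V_right[symmetric] funpow_swap1)
  show ?thesis by (cases k "0::int" rule: linorder_cases) (simp_all add: zpow_def V W)
qed

end

section \<open>Continuous functional calculus\<close>

text \<open>\<open>M\<close> lives on angles in the real line, but is only ever integrated through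
  \<open>cis\<close>, so it acts as a measure on the circle. Only nonnegative moments are assumed;
  the negative ones follow by conjugation in \<open>moment_int\<close>.\<close>

locale spectral_rep = unitary_pair V W + M: real_distribution M
  for V W :: "'a::{complex_inner, complete_space} \<Rightarrow> 'a" and M +
  fixes psi :: 'a
  assumes moment: "cinner psi ((V ^^ k) psi) = (\<integral>t. cis (real k * t) \<partial>M)"
begin

abbreviation circle :: "complex set" where "circle \<equiv> sphere 0 1"

abbreviation cint :: "(complex \<Rightarrow> complex) \<Rightarrow> complex" where
  "cint f \<equiv> \<integral>t. f (cis t) \<partial>M"

lemma integrable_circle:
  fixes f :: "complex \<Rightarrow> 'b::{banach, second_countable_topology}"
  assumes f: "continuous_on circle f"
  shows "integrable M (\<lambda>t. f (cis t))"
proof -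
  have "bounded (f ` circle)"
    by (intro compact_imp_bounded compact_continuous_image f) simp
  then obtain B where "\<forall>w\<in>circle. norm (f w) \<le> B" unfolding bounded_iff by blast
  moreover have "continuous_on UNIV (\<lambda>t. f (cis t))"
    by (rule continuous_on_compose2[OF f]) (auto intro!: continuous_intros)
  ultimately show ?thesis
    by (intro M.integrable_const_bound[of _ B])
      (auto intro!: borel_measurable_continuous_onI simp: measurable_cong_sets[OF M.events_eq_borel refl])
qed

lemma moment_int: "cinner psi (zpow k psi) = cint (\<lambda>w. w powi k)"
proof (cases "0 \<le> k")
  case True
  hence "cis (real (nat k) * t) = cis t powi k" for t by (simp only: power_int_def Complex.DeMoivre if_True)
  thus ?thesis using True by (simp only: zpow_def moment if_True)
next
  case False
  have "cinner psi (zpow k psi) = cnj (cinner psi ((V ^^ nat (- k)) psi))"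
    using False by (subst cinner_conj, subst cinner_zpow) (simp add: zpow_def)
  also have "\<dots> = cint (\<lambda>w. w powi k)"
    unfolding moment Bochner_Integration.integral_cnj[symmetric]
  proof (intro Bochner_Integration.integral_cong refl)
    show "cnj (cis (real (nat (- k)) * t)) = cis t powi k" for t
      using False by (simp add: cis_cnj cis_power_int)
  qed
  finally show ?thesis .
qed

text \<open>Pairs a trigonometric polynomial \<open>f\<close> with the vector
  \<open>f(V) psi\<close>. A relation avoids having to show at this stage that the vector depends on
  \<open>f\<close> alone. On the circle \<open>cnj w\<close> is the inverse of \<open>w\<close>, so
  it corresponds to \<open>W\<close>.\<close>

inductive laurent :: "(complex \<Rightarrow> complex) \<Rightarrow> 'a \<Rightarrow> bool" where
  one: "laurent (\<lambda>_. 1) psi"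
| V: "laurent f x \<Longrightarrow> laurent (\<lambda>w. w * f w) (V x)"
| W: "laurent f x \<Longrightarrow> laurent (\<lambda>w. cnj w * f w) (W x)"
| add: "laurent f x \<Longrightarrow> laurent g y \<Longrightarrow> laurent (\<lambda>w. f w + g w) (x + y)"
| scale: "laurent f x \<Longrightarrow> laurent (\<lambda>w. a * f w) (scaleC a x)"

lemma laurent_continuous: "laurent f x \<Longrightarrow> continuous_on S f"
  by (induction rule: laurent.induct) (auto intro!: continuous_intros)

lemma integrable_laurent: "laurent f x \<Longrightarrow> continuous_on circle g \<Longrightarrow> integrable M (\<lambda>t. g (cis t) * f (cis t))"
  by (rule integrable_circle) (auto intro: continuous_on_mult laurent_continuous)

lemma continuous_on_powi: "continuous_on circle (\<lambda>w. w powi k)"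
  by (intro continuous_intros) auto

text \<open>A leading \<open>V\<close> or \<open>W\<close> in the right argument can be moved to the
  left one, where it shifts the exponent by one; hence the induction over \<open>laurent\<close>
  with \<open>k\<close> arbitrary, ending at the moments.\<close>

lemma cinner_zpow_laurent:
  "laurent f x \<Longrightarrow> cinner (zpow k psi) x = cint (\<lambda>w. w powi (- k) * f w)"
proof (induction arbitrary: k rule: laurent.induct)
  case one
  show ?case by (simp add: cinner_zpow moment_int)
next
  case (V f x)
  have "cis t * cis t powi (- k) = cis t powi (1 - k)" for t
    by (simp add: power_int_add power_int_diff power_int_minus field_simps)
  thus ?case by (simp add: cinner_V_right W_zpow V mult.assoc[symmetric] mult.commute)
next
  case (W f x)
  have "cnj (cis t) * cis t powi (- k) = cis t powi (- k - 1)" for t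
    by (simp add: power_int_diff power_int_minus field_simps cis_cnj flip: cis_inverse)
  thus ?case by (simp add: cinner_V_left[symmetric] V_zpow W mult.assoc[symmetric] mult.commute)
next
  case (add f x g y)
  show ?case
    by (simp add: cinner_add_right add.IH distrib_left
        integrable_laurent[OF add.hyps(1) continuous_on_powi] integrable_laurent[OF add.hyps(2) continuous_on_powi])
next
  case (scale f x a)
  thus ?case by (simp add: cinner_scaleC_right mult.left_commute)
qed

text \<open>The induction now runs over the left argument with the right one arbitrary: a
  \<open>V\<close> moved across becomes a \<open>W\<close>, which stays within
  \<open>laurent\<close>. The base case is the previous lemma with exponent 0.\<close>

lemma cinner_laurent:
  assumes "laurent f x" "laurent g y"
  shows "cinner x y = cint (\<lambda>w. cnj (f w) * g w)"
  using assms
proof (induction arbitrary: g y rule: laurent.induct)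
  case one
  thus ?case using cinner_zpow_laurent[OF one, of 0] by (simp add: zpow_def)
next
  case (V f x)
  show ?case using V.IH[OF laurent.W[OF V.prems]] by (simp add: cinner_V_left mult_ac)
next
  case (W f x)
  show ?case using W.IH[OF laurent.V[OF W.prems]] by (simp add: cinner_V_right[symmetric] mult_ac)
next
  case (add f x g' z)
  have "integrable M (\<lambda>t. cnj (f (cis t)) * g (cis t))" if "laurent f x" for f x
    by (intro integrable_laurent[OF add.prems] continuous_on_cnj laurent_continuous[OF that])
  from this[OF add.hyps(1)] this[OF add.hyps(2)] show ?case
    by (simp add: cinner_add_left add.IH[OF add.prems] distrib_right)
next
  case (scale f x a)
  show ?case by (simp add: cinner_scaleC_left scale.IH[OF scale.prems] mult.assoc)
qed

lemma laurent_diff: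
  assumes "laurent f x" "laurent g y"
  shows "laurent (\<lambda>w. f w - g w) (x - y)"
  using laurent.add[OF assms(1) laurent.scale[OF assms(2), of "-1"]] by (simp add: scaleC_minus_one)

lemma cmod_cint_le:
  assumes f: "continuous_on circle f" and B: "\<And>w. w \<in> circle \<Longrightarrow> cmod (f w) \<le> B"
  shows "cmod (cint f) \<le> B"
proof -
  have "cmod (cint f) \<le> (\<integral>t. cmod (f (cis t)) \<partial>M)" by (rule integral_norm_bound)
  also have "\<dots> \<le> (\<integral>t. B \<partial>M)"
    by (intro integral_mono integrable_norm integrable_circle f) (auto simp: B)
  finally show ?thesis using M.prob_space by simp
qed

text \<open>The bound by the supremum norm makes uniformly Cauchy polynomials yield Cauchy vectors,
  which is what extends the calculus to continuous functions.\<close>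

lemma norm_laurent_le:
  assumes l: "laurent f x" and B: "\<And>w. w \<in> circle \<Longrightarrow> cmod (f w) \<le> B"
  shows "norm x \<le> B"
proof -
  have B0: "0 \<le> B" using order_trans[OF norm_ge_zero B[of 1]] by simp
  have "(norm x)\<^sup>2 = cmod (cinner x x)" by (simp add: cinner_self norm_power)
  also have "\<dots> \<le> B\<^sup>2"
    unfolding cinner_laurent[OF l l]
    by (intro cmod_cint_le continuous_intros laurent_continuous[OF l])
      (auto simp: norm_mult power2_eq_square B B0 intro!: mult_mono)
  finally show ?thesis using B0 by (rule power2_le_imp_le)
qed

lemma laurent_mult: "laurent f x \<Longrightarrow> laurent g y \<Longrightarrow> \<exists>z. laurent (\<lambda>w. f w * g w) z"
proof (induction rule: laurent.induct)
  case one
  thus ?case by auto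
next
  case (V f x)
  thus ?case using laurent.V by (fastforce simp: mult.assoc)
next
  case (W f x)
  thus ?case using laurent.W by (fastforce simp: mult.assoc)
next
  case (add f x h z)
  thus ?case using laurent.add by (fastforce simp: distrib_right)
next
  case (scale f x a)
  thus ?case using laurent.scale by (fastforce simp: mult.assoc)
qed

text \<open>Stone-Weierstrass for the real-valued trigonometric polynomials; \<open>Re\<close> and
  \<open>Im\<close> are among them, being combinations of \<open>w\<close> and \<open>cnj w\<close>,
  and together they separate points.\<close>

lemma laurent_approx_real:
  assumes f: "continuous_on circle f" and e: "0 < e"
  shows "\<exists>h. (\<exists>x. laurent (\<lambda>w. complex_of_real (h w)) x) \<and> (\<forall>w\<in>circle. \<bar>f w - h w\<bar> < e)"
proof -
  let ?P = "\<lambda>h. \<exists>x. laurent (\<lambda>w. complex_of_real (h w)) x"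
  have Re: "?P Re"
  proof -
    have "(\<lambda>w. complex_of_real (Re w)) = (\<lambda>w. (1/2) * (w * 1 + cnj w * 1))"
      by (auto simp: fun_eq_iff complex_eq_iff)
    thus ?thesis using laurent.scale[OF laurent.add[OF laurent.V[OF laurent.one] laurent.W[OF laurent.one]], of "1/2"]
      by auto
  qed
  have Im: "?P Im"
  proof -
    have "(\<lambda>w. complex_of_real (Im w)) = (\<lambda>w. (- \<i> / 2) * (w * 1 + (- 1) * (cnj w * 1)))"
      by (auto simp: fun_eq_iff complex_eq_iff)
    thus ?thesis using laurent.scale[OF laurent.add[OF laurent.V[OF laurent.one]
      laurent.scale[OF laurent.W[OF laurent.one], of "-1"]], of "- \<i> / 2"]
      by auto
  qed
  show ?thesis
  proof (rule Stone_Weierstrass_HOL[of circle ?P f e])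
    show "?P (\<lambda>x. c)" for c using laurent.scale[OF laurent.one, of "of_real c"] by auto
    show "continuous_on circle h" if "?P h" for h
      using that laurent_continuous[of "\<lambda>w. of_real (h w)" _ circle]
      by (auto dest!: continuous_on_Re)
    show "?P (\<lambda>x. h x + k x)" if "?P h \<and> ?P k" for h k
      using that laurent.add by fastforce
    show "?P (\<lambda>x. h x * k x)" if "?P h \<and> ?P k" for h k
      using that laurent_mult by fastforce
    show "\<exists>h. ?P h \<and> h x \<noteq> h y" if "x \<in> circle \<and> y \<in> circle \<and> x \<noteq> y" for x y
      using Re Im that complex_eq_iff by blast
  qed (use f e in auto)
qed

lemma laurent_approx:
  assumes f: "continuous_on circle f" and e: "0 < e"
  shows "\<exists>g x. laurent g x \<and> (\<forall>w\<in>circle. cmod (f w - g w) < e)"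
proof -
  obtain h x where h: "laurent (\<lambda>w. complex_of_real (h w)) x" "\<And>w. w \<in> circle \<Longrightarrow> \<bar>Re (f w) - h w\<bar> < e/2"
    using laurent_approx_real[OF continuous_on_Re[OF f], of "e/2"] e by auto
  obtain k y where k: "laurent (\<lambda>w. complex_of_real (k w)) y" "\<And>w. w \<in> circle \<Longrightarrow> \<bar>Im (f w) - k w\<bar> < e/2"
    using laurent_approx_real[OF continuous_on_Im[OF f], of "e/2"] e by auto
  have "cmod (f w - (of_real (h w) + \<i> * of_real (k w))) < e" if "w \<in> circle" for w
    using cmod_le[of "f w - (of_real (h w) + \<i> * of_real (k w))"] h(2)[OF that] k(2)[OF that] by simp
  thus ?thesis using laurent.add[OF h(1) laurent.scale[OF k(1), of \<i>]] by blast
qed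

text \<open>\<open>calc f x\<close> means \<open>x = f(V) psi\<close> in the sense of the continuous functional calculus.\<close>

definition calc :: "(complex \<Rightarrow> complex) \<Rightarrow> 'a \<Rightarrow> bool" where
  "calc f x \<longleftrightarrow> continuous_on circle f \<and>
    (\<forall>e>0. \<exists>g y. laurent g y \<and> (\<forall>w\<in>circle. cmod (f w - g w) < e) \<and> norm (x - y) < e)"

lemma calc_continuous: "calc f x \<Longrightarrow> continuous_on circle f"
  by (simp add: calc_def)

lemma calc_approx:
  assumes "calc f x" "0 < e"
  obtains g y where "laurent g y" "\<And>w. w \<in> circle \<Longrightarrow> cmod (f w - g w) < e" "norm (x - y) < e"
  using assms by (auto simp: calc_def)

lemma calc_one: "calc (\<lambda>_. 1) psi"
  unfolding calc_def using laurent.one by (auto intro!: continuous_intros exI[of _ "\<lambda>_. 1"] exI[of _ psi])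

lemma calc_V:
  assumes "calc f x"
  shows "calc (\<lambda>w. w * f w) (V x)"
  unfolding calc_def
proof (intro conjI allI impI)
  show "continuous_on circle (\<lambda>w. w * f w)" by (intro continuous_intros calc_continuous[OF assms])
  fix e :: real assume "0 < e"
  from calc_approx[OF assms this] obtain g y where
    g: "laurent g y" "\<And>w. w \<in> circle \<Longrightarrow> cmod (f w - g w) < e" "norm (x - y) < e" by blast
  have "cmod (w * f w - w * g w) < e" if "w \<in> circle" for w
    using g(2)[OF that] that by (simp add: norm_mult flip: right_diff_distrib)
  moreover have "norm (V x - V y) < e" using g(3) by (simp add: norm_V flip: V_diff)
  ultimately show "\<exists>g y. laurent g y \<and> (\<forall>w\<in>circle. cmod (w * f w - g w) < e) \<and> norm (V x - y) < e"
    using laurent.V[OF g(1)] by blast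
qed

lemma calc_add:
  assumes "calc f x" "calc g y"
  shows "calc (\<lambda>w. f w + g w) (x + y)"
  unfolding calc_def
proof (intro conjI allI impI)
  show "continuous_on circle (\<lambda>w. f w + g w)" by (intro continuous_intros calc_continuous[OF assms(1)] calc_continuous[OF assms(2)])
  fix e :: real assume e: "0 < e"
  obtain f' x' where f: "laurent f' x'" "\<And>w. w \<in> circle \<Longrightarrow> cmod (f w - f' w) < e/2" "norm (x - x') < e/2"
    using calc_approx[OF assms(1), of "e/2"] e by auto
  obtain g' y' where g: "laurent g' y'" "\<And>w. w \<in> circle \<Longrightarrow> cmod (g w - g' w) < e/2" "norm (y - y') < e/2"
    using calc_approx[OF assms(2), of "e/2"] e by auto
  have "cmod ((f w + g w) - (f' w + g' w)) < e" if "w \<in> circle" for w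
    using norm_diff_triangle_ineq[of "f w" "g w" "f' w" "g' w"] f(2)[OF that] g(2)[OF that] by simp
  moreover have "norm ((x + y) - (x' + y')) < e"
    using norm_diff_triangle_ineq[of x y x' y'] f(3) g(3) by simp
  ultimately show "\<exists>h z. laurent h z \<and> (\<forall>w\<in>circle. cmod (f w + g w - h w) < e) \<and> norm (x + y - z) < e"
    using laurent.add[OF f(1) g(1)] by blast
qed

lemma calc_scale:
  assumes "calc f x"
  shows "calc (\<lambda>w. a * f w) (scaleC a x)"
  unfolding calc_def
proof (intro conjI allI impI)
  show "continuous_on circle (\<lambda>w. a * f w)" by (intro continuous_intros calc_continuous[OF assms])
  fix e :: real assume e: "0 < e"
  hence "0 < e / (cmod a + 1)" by (simp add: add_nonneg_pos)
  from calc_approx[OF assms this] obtain g y where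
    g: "laurent g y" "\<And>w. w \<in> circle \<Longrightarrow> cmod (f w - g w) < e / (cmod a + 1)" "norm (x - y) < e / (cmod a + 1)"
    by blast
  have scale: "cmod a * r < e" if "r < e / (cmod a + 1)" "0 \<le> r" for r
  proof -
    have "(cmod a + 1) * r < e" using that(1) by (simp add: pos_less_divide_eq add_nonneg_pos mult.commute)
    thus ?thesis using that(2) by (simp add: distrib_right)
  qed
  have "cmod (a * f w - a * g w) < e" if "w \<in> circle" for w
    using scale[OF g(2)[OF that]] by (simp add: norm_mult flip: right_diff_distrib)
  moreover have "norm (scaleC a x - scaleC a y) < e"
    using scale[OF g(3)] by (simp flip: scaleC_diff_right)
  ultimately show "\<exists>g y. laurent g y \<and> (\<forall>w\<in>circle. cmod (a * f w - g w) < e) \<and> norm (scaleC a x - y) < e"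
    using laurent.scale[OF g(1)] by blast
qed

lemma calc_diff:
  assumes "calc f x" "calc g y"
  shows "calc (\<lambda>w. f w - g w) (x - y)"
  using calc_add[OF assms(1) calc_scale[OF assms(2), of "-1"]] by (simp add: scaleC_minus_one)

lemma calc_exists:
  assumes f: "continuous_on circle f"
  shows "\<exists>x. calc f x"
proof -
  have "\<forall>n. \<exists>g x. laurent g x \<and> (\<forall>w\<in>circle. cmod (f w - g w) < 1 / real (Suc n))"
    by (intro allI laurent_approx f) simp
  then obtain g x where l: "\<And>n. laurent (g n) (x n)"
    and g: "\<And>n w. w \<in> circle \<Longrightarrow> cmod (f w - g n w) < 1 / real (Suc n)" by metis
  have bd: "norm (x m - x n) \<le> 1 / real (Suc m) + 1 / real (Suc n)" for m n
  proof (rule norm_laurent_le[OF laurent_diff[OF l l]])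
    fix w assume w: "w \<in> circle"
    have "cmod (g m w - g n w) \<le> cmod (f w - g m w) + cmod (f w - g n w)"
      using norm_triangle_ineq4[of "f w - g n w" "f w - g m w"] by simp
    thus "cmod (g m w - g n w) \<le> 1 / real (Suc m) + 1 / real (Suc n)" using g[OF w, of m] g[OF w, of n] by linarith
  qed
  have small: "\<exists>N. \<forall>n\<ge>N. 1 / real (Suc n) < e" if "0 < e" for e :: real
    using order_tendstoD(2)[OF LIMSEQ_inverse_real_of_nat that]
    by (simp add: eventually_sequentially inverse_eq_divide)
  have "Cauchy x"
  proof (rule metric_CauchyI)
    fix e :: real assume "0 < e"
    then obtain N where N: "\<And>n. n \<ge> N \<Longrightarrow> 1 / real (Suc n) < e/2" using small[of "e/2"] by auto
    show "\<exists>M. \<forall>m\<ge>M. \<forall>n\<ge>M. dist (x m) (x n) < e"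
    proof (intro exI[of _ N] allI impI)
      fix m n assume "N \<le> m" "N \<le> n"
      thus "dist (x m) (x n) < e" using bd[of m n] N[of m] N[of n] unfolding dist_norm by linarith
    qed
  qed
  then obtain v where v: "x \<longlonglongrightarrow> v" using Cauchy_convergent convergent_def by blast
  have "calc f v"
    unfolding calc_def
  proof (intro conjI allI impI f)
    fix e :: real assume e: "0 < e"
    obtain N where N: "\<And>n. n \<ge> N \<Longrightarrow> 1 / real (Suc n) < e" using small[OF e] by auto
    obtain N' where N': "\<And>n. n \<ge> N' \<Longrightarrow> dist (x n) v < e" using metric_LIMSEQ_D[OF v e] by auto
    let ?n = "max N N'"
    have "\<forall>w\<in>circle. cmod (f w - g ?n w) < e"
      using g[of _ ?n] N[of ?n] by (metis less_trans max.cobounded1)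
    moreover have "norm (v - x ?n) < e" using N'[of ?n] by (simp add: dist_norm norm_minus_commute)
    ultimately show "\<exists>g y. laurent g y \<and> (\<forall>w\<in>circle. cmod (f w - g w) < e) \<and> norm (v - y) < e"
      using l by blast
  qed
  thus ?thesis ..
qed

text \<open>The bound by \<open>cmod (f w) + 1\<close> provides the dominating function when the
  inner product formula is passed to the limit.\<close>

lemma calc_sequence:
  assumes "calc f x"
  obtains g y where "\<And>n. laurent (g n) (y n)" "y \<longlonglongrightarrow> x"
    "\<And>w. w \<in> circle \<Longrightarrow> (\<lambda>n. g n w) \<longlonglongrightarrow> f w"
    "\<And>n w. w \<in> circle \<Longrightarrow> cmod (g n w) \<le> cmod (f w) + 1"
proof -
  have "\<exists>g y. laurent g y \<and> (\<forall>w\<in>circle. cmod (f w - g w) < 1 / real (Suc n)) \<and> norm (x - y) < 1 / real (Suc n)" for n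
    using assms unfolding calc_def by simp
  then obtain g y where l: "\<And>n. laurent (g n) (y n)"
    and g: "\<And>n w. w \<in> circle \<Longrightarrow> cmod (f w - g n w) < 1 / real (Suc n)"
    and y: "\<And>n. norm (x - y n) < 1 / real (Suc n)" by metis
  have z: "(\<lambda>n. 1 / real (Suc n)) \<longlonglongrightarrow> 0"
    using LIMSEQ_inverse_real_of_nat by (simp add: inverse_eq_divide)
  have "y \<longlonglongrightarrow> x"
  proof (rule metric_tendsto_imp_tendsto[OF z])
    show "\<forall>\<^sub>F n in sequentially. dist (y n) x \<le> dist (1 / real (Suc n)) 0"
      using less_imp_le[OF y] by (intro always_eventually) (simp add: dist_norm norm_minus_commute)
  qed
  moreover have "(\<lambda>n. g n w) \<longlonglongrightarrow> f w" if "w \<in> circle" for w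
  proof (rule metric_tendsto_imp_tendsto[OF z])
    show "\<forall>\<^sub>F n in sequentially. dist (g n w) (f w) \<le> dist (1 / real (Suc n)) 0"
      using less_imp_le[OF g[OF that]] by (intro always_eventually) (simp add: dist_norm norm_minus_commute)
  qed
  moreover have "cmod (g n w) \<le> cmod (f w) + 1" if "w \<in> circle" for n w
  proof -
    have "1 / real (Suc n) \<le> 1" by simp
    moreover have "cmod (g n w) \<le> cmod (f w) + cmod (f w - g n w)"
      using norm_triangle_ineq4[of "f w" "f w - g n w"] by simp
    ultimately show ?thesis using g[OF that, of n] by linarith
  qed
  ultimately show ?thesis using that l by blast
qed

lemma cinner_calc:
  assumes "calc f x" "calc g y"
  shows "cinner x y = cint (\<lambda>w. cnj (f w) * g w)"
proof -
  obtain f' x' where f: "\<And>n. laurent (f' n) (x' n)" "x' \<longlonglongrightarrow> x"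
    "\<And>w. w \<in> circle \<Longrightarrow> (\<lambda>n. f' n w) \<longlonglongrightarrow> f w"
    "\<And>n w. w \<in> circle \<Longrightarrow> cmod (f' n w) \<le> cmod (f w) + 1"
    using calc_sequence[OF assms(1)] by blast
  obtain g' y' where g: "\<And>n. laurent (g' n) (y' n)" "y' \<longlonglongrightarrow> y"
    "\<And>w. w \<in> circle \<Longrightarrow> (\<lambda>n. g' n w) \<longlonglongrightarrow> g w"
    "\<And>n w. w \<in> circle \<Longrightarrow> cmod (g' n w) \<le> cmod (g w) + 1"
    using calc_sequence[OF assms(2)] by blast
  note cont = calc_continuous[OF assms(1)] calc_continuous[OF assms(2)]
    laurent_continuous[OF f(1)] laurent_continuous[OF g(1)]
  have "(\<lambda>n. cint (\<lambda>w. cnj (f' n w) * g' n w)) \<longlonglongrightarrow> cint (\<lambda>w. cnj (f w) * g w)"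
  proof (rule integral_dominated_convergence[of _ _ _ "\<lambda>t. (cmod (f (cis t)) + 1) * (cmod (g (cis t)) + 1)"])
    show "(\<lambda>t. cnj (f (cis t)) * g (cis t)) \<in> borel_measurable M"
      by (intro borel_measurable_integrable integrable_circle[of "\<lambda>w. cnj (f w) * g w"] continuous_intros cont)
    show "(\<lambda>t. cnj (f' n (cis t)) * g' n (cis t)) \<in> borel_measurable M" for n
      by (intro borel_measurable_integrable integrable_circle[of "\<lambda>w. cnj (f' n w) * g' n w"] continuous_intros cont)
    show "integrable M (\<lambda>t. (cmod (f (cis t)) + 1) * (cmod (g (cis t)) + 1))"
      by (rule integrable_circle[of "\<lambda>w. (cmod (f w) + 1) * (cmod (g w) + 1)"]) (intro continuous_intros cont)
    show "AE t in M. (\<lambda>n. cnj (f' n (cis t)) * g' n (cis t)) \<longlonglongrightarrow> cnj (f (cis t)) * g (cis t)"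
      by (intro always_eventually allI tendsto_intros f g) auto
    show "AE t in M. cmod (cnj (f' n (cis t)) * g' n (cis t)) \<le> (cmod (f (cis t)) + 1) * (cmod (g (cis t)) + 1)" for n
      by (intro always_eventually allI) (auto simp: norm_mult intro!: mult_mono f g)
  qed
  moreover have "(\<lambda>n. cinner (x' n) (y' n)) \<longlonglongrightarrow> cinner x y" by (intro cinner.tendsto f g)
  ultimately show ?thesis using LIMSEQ_unique cinner_laurent[OF f(1) g(1)] by fastforce
qed

lemma calc_unique:
  assumes "calc f x" "calc g y" "\<And>w. w \<in> circle \<Longrightarrow> f w = g w"
  shows "x = y"
proof -
  note d = calc_diff[OF assms(1,2)]
  have "cinner (x - y) (x - y) = cint (\<lambda>w. cnj (f w - g w) * (f w - g w))"
    by (rule cinner_calc[OF d d])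
  also have "\<dots> = 0" by (simp add: assms(3))
  finally show ?thesis by (simp add: cinner_eq_zero_iff)
qed

end

section \<open>Baire and Vitali arguments on the line\<close>

text \<open>The sets \<open>E n\<close> where the bound holds with threshold \<open>n\<close> are
  closed, by continuity in \<open>x\<close> at each fixed \<open>e\<close>, and they cover
  \<open>[c,d]\<close>. If none contained a nondegenerate interval, their complements would be open
  and dense in \<open>[c,d]\<close> with empty intersection.\<close>

lemma Baire_uniform_lower_bound:
  fixes h :: "real \<Rightarrow> real \<Rightarrow> real"
  assumes cd: "c < d"
    and cont: "\<And>e. 0 < e \<Longrightarrow> continuous_on UNIV (\<lambda>x. h x e)"
    and pt: "\<And>x. x \<in> {c..d} \<Longrightarrow> \<exists>n. \<forall>e. 0 < e \<and> e < 1 / real (Suc n) \<longrightarrow> 1 / real (Suc n) \<le> h x e"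
  obtains a b n where "c \<le> a" "a < b" "b \<le> d"
    "\<And>x e. a \<le> x \<Longrightarrow> x \<le> b \<Longrightarrow> 0 < e \<Longrightarrow> e < 1 / real (Suc n) \<Longrightarrow> 1 / real (Suc n) \<le> h x e"
proof (rule ccontr)
  define E where "E n = {x. \<forall>e. 0 < e \<and> e < 1 / real (Suc n) \<longrightarrow> 1 / real (Suc n) \<le> h x e}" for n
  assume "\<not> thesis"
  note witness = that
  have not: "\<not> {a..b} \<subseteq> E n" if ab: "c \<le> a" "a < b" "b \<le> d" for a b n
  proof
    assume "{a..b} \<subseteq> E n"
    hence thesis by (intro witness[of a b n] ab) (auto simp: E_def)
    with \<open>\<not> thesis\<close> show False ..
  qed
  have "{c..d} \<subseteq> closure (\<Inter> (range (\<lambda>n. {c..d} - E n)))"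
  proof (rule Baire)
    fix T assume "T \<in> range (\<lambda>n. {c..d} - E n)"
    then obtain n where T: "T = {c..d} - E n" by auto
    have "E n = (\<Inter>e\<in>{0<..<1 / real (Suc n)}. {x. 1 / real (Suc n) \<le> h x e})"
      by (auto simp: E_def)
    moreover have "closed {x. 1 / real (Suc n) \<le> h x e}" if "0 < e" for e
      by (intro closed_Collect_le continuous_on_const cont that)
    ultimately have "closed (E n)" by (auto intro!: closed_INT)
    hence "openin (top_of_set {c..d}) T"
      unfolding T Diff_eq by (intro openin_open_Int) (simp add: open_Compl)
    moreover have "{c..d} \<subseteq> closure T"
    proof
      fix x assume x: "x \<in> {c..d}"
      show "x \<in> closure T"
        unfolding closure_approachable
      proof (intro allI impI)
        fix e :: real assume e: "0 < e"
        define a b where "a = max c (x - e/2)" and "b = min d (x + e/2)"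
        have "c \<le> a" "a < b" "b \<le> d" using x e cd by (auto simp: a_def b_def)
        then obtain y where y: "y \<in> {a..b}" "y \<notin> E n" using not by blast
        have "dist y x < e" using y(1) e by (auto simp: a_def b_def dist_real_def)
        moreover have "y \<in> T" using y by (auto simp: T a_def b_def)
        ultimately show "\<exists>y\<in>T. dist y x < e" by blast
      qed
    qed
    ultimately show "openin (top_of_set {c..d}) T \<and> {c..d} \<subseteq> closure T" ..
  qed auto
  moreover have "(\<Inter> (range (\<lambda>n. {c..d} - E n))) = {}"
    using pt cd by (force simp: E_def)
  ultimately have "{c..d} \<subseteq> {}" by (simp only: closure_empty)
  thus False using cd by simp
qed

text \<open>Subadditivity in the shape needed after the Vitali covering lemma: the enlarged balls
  overlap and are indexed by a countable set of centres, so the sum is an integral over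
  \<open>count_space\<close>.\<close>

lemma emeasure_UN_countable_le:
  assumes [measurable]: "\<And>i. i \<in> I \<Longrightarrow> X i \<in> sets M" and I: "countable I"
  shows "emeasure M (\<Union>i\<in>I. X i) \<le> (\<integral>\<^sup>+i. emeasure M (X i) \<partial>count_space I)"
proof -
  have le: "indicator (\<Union>i\<in>I. X i) x \<le> (\<integral>\<^sup>+i. indicator (X i) x \<partial>count_space I)" for x
  proof (cases "x \<in> (\<Union>i\<in>I. X i)")
    case True
    then obtain j where j: "j \<in> I" "x \<in> X j" by auto
    have "1 = (\<integral>\<^sup>+i. indicator {j} i \<partial>count_space I)" using j by simp
    also have "\<dots> \<le> (\<integral>\<^sup>+i. indicator (X i) x \<partial>count_space I)"
      using j by (intro nn_integral_mono) (auto simp: indicator_def)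
    finally show ?thesis using True by simp
  qed simp
  have "emeasure M (\<Union>i\<in>I. X i) = (\<integral>\<^sup>+x. indicator (\<Union>i\<in>I. X i) x \<partial>M)"
    using I by (intro nn_integral_indicator[symmetric] sets.countable_UN') auto
  also have "\<dots> \<le> (\<integral>\<^sup>+x. \<integral>\<^sup>+i. indicator (X i) x \<partial>count_space I \<partial>M)"
    by (intro nn_integral_mono le)
  also have "\<dots> = (\<integral>\<^sup>+i. \<integral>\<^sup>+x. indicator (X i) x \<partial>M \<partial>count_space I)"
    by (intro nn_integral_count_space_nn_integral I) simp
  also have "\<dots> = (\<integral>\<^sup>+i. emeasure M (X i) \<partial>count_space I)"
    by (intro nn_integral_cong) simp
  finally show ?thesis .
qed

text \<open>Enclose \<open>N\<close> in an open set of small length and choose disjoint Vitali balls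
  inside it. Their fivefold enlargements cover \<open>N\<close>, and the bound controls their
  \<open>m\<close>-mass by the total length of the disjoint balls.\<close>

lemma null_set_if_cball_bound:
  fixes m :: "real measure"
  assumes "finite_measure m" and sets: "sets m = sets borel" and rmax: "0 < rmax" and C: "0 \<le> C"
    and bound: "\<And>x r. x \<in> S \<Longrightarrow> 0 < r \<Longrightarrow> r < rmax \<Longrightarrow> measure m (cball x r) \<le> C * r"
    and N: "N \<in> null_sets lborel" "N \<subseteq> S"
  shows "N \<in> null_sets m"
proof -
  interpret finite_measure m by fact
  have Nb: "N \<in> sets borel" using N(1) by (auto simp: null_sets_def)
  have small: "emeasure m N \<le> ennreal (5 * C) * ennreal e" if e: "0 < e" for e :: real
  proof -
    obtain U where U: "open U" "N \<subseteq> U" and "emeasure lborel (U - N) < ennreal e"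
      using outer_regular_lborel[OF Nb e] by blast
    moreover have "emeasure lborel (U - N) = emeasure lborel U"
      by (rule emeasure_Diff_null_set[OF N(1)]) (use U in simp)
    ultimately have Ue: "emeasure lborel U < ennreal e" by simp
    \<comment> \<open>Radii stay below \<open>rmax / 5\<close> so that \<open>bound\<close> still
      applies after the fivefold enlargement.\<close>
    have "\<exists>r. 0 < r \<and> r < rmax / 5 \<and> cball x r \<subseteq> U" if xN: "x \<in> N" for x
    proof -
      obtain s where s: "0 < s" "cball x s \<subseteq> U" 
        using U(1)[unfolded open_contains_cball] U(2) xN by blast
      have "cball x (min s (rmax / 10)) \<subseteq> U"
        by (rule order_trans[OF subset_cball s(2)]) simp
      moreover have "0 < min s (rmax / 10)" "min s (rmax / 10) < rmax / 5" using s(1) rmax by auto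
      ultimately show ?thesis by blast
    qed
    hence "\<forall>x\<in>N. \<exists>r. 0 < r \<and> r < rmax / 5 \<and> cball x r \<subseteq> U" by blast
    from bchoice[OF this] obtain r where r: "\<And>x. x \<in> N \<Longrightarrow> 0 < r x \<and> r x < rmax / 5 \<and> cball x (r x) \<subseteq> U"
      by blast
    obtain K where K: "countable K" "K \<subseteq> N" "pairwise (\<lambda>i j. disjnt (cball i (r i)) (cball j (r j))) K"
      "N \<subseteq> (\<Union>i\<in>K. cball i (5 * r i))"
      by (rule Vitali_covering_lemma_cballs[where S = N and K = N and a = "\<lambda>x. x" and r = r and B = "rmax / 5"])
        (use r in \<open>force+\<close>)
    have em: "emeasure m (cball i (5 * r i)) \<le> ennreal (5 * C) * emeasure lborel (cball i (r i))" if "i \<in> K" for i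
    proof -
      have ri: "0 < r i" "r i < rmax / 5" "i \<in> N" using r K that by auto
      have "emeasure m (cball i (5 * r i)) \<le> ennreal (C * (5 * r i))"
        unfolding emeasure_eq_measure using ri N(2) by (intro ennreal_leI bound) auto
      also have "\<dots> \<le> ennreal (5 * C * (2 * r i))" using C ri by (intro ennreal_leI) (auto intro!: mult_mono)
      also have "\<dots> = ennreal (5 * C) * emeasure lborel (cball i (r i))"
        using C ri by (simp add: cball_eq_atLeastAtMost ennreal_mult[symmetric])
      finally show ?thesis .
    qed
    have "emeasure m N \<le> emeasure m (\<Union>i\<in>K. cball i (5 * r i))"
      using K by (intro emeasure_mono) (auto simp: sets intro!: sets.countable_UN')
    also have "\<dots> \<le> (\<integral>\<^sup>+i. emeasure m (cball i (5 * r i)) \<partial>count_space K)"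
      using K(1) by (intro emeasure_UN_countable_le) (auto simp: sets)
    also have "\<dots> \<le> (\<integral>\<^sup>+i. ennreal (5 * C) * emeasure lborel (cball i (r i)) \<partial>count_space K)"
      by (intro nn_integral_mono em) simp
    also have "\<dots> = ennreal (5 * C) * (\<integral>\<^sup>+i. emeasure lborel (cball i (r i)) \<partial>count_space K)"
      by (intro nn_integral_cmult) simp
    also have "(\<integral>\<^sup>+i. emeasure lborel (cball i (r i)) \<partial>count_space K) = emeasure lborel (\<Union>i\<in>K. cball i (r i))"
      using K by (intro emeasure_UN_countable[symmetric])
        (auto simp: disjoint_family_on_def pairwise_def disjnt_def)
    also have "\<dots> \<le> emeasure lborel U"
      using r K(2) U by (intro emeasure_mono) auto
    also have "\<dots> \<le> ennreal e" using Ue by simp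
    finally show ?thesis by (simp add: mult_left_mono)
  qed
  have "measure m N \<le> 0"
  proof (rule field_le_epsilon)
    fix e :: real assume e: "0 < e"
    \<comment> \<open>Dividing by \<open>5 * C + 1\<close> rather than \<open>5 * C\<close> covers
      the case \<open>C = 0\<close>.\<close>
    have C1: "0 < 5 * C + 1" using C by simp
    have "emeasure m N \<le> ennreal (5 * C * (e / (5 * C + 1)))"
      using small[of "e / (5 * C + 1)"] e C C1 by (simp add: ennreal_mult[symmetric])
    also have "\<dots> \<le> ennreal e" using e C C1 by (intro ennreal_leI) (simp add: field_simps)
    finally show "measure m N \<le> 0 + e" using e by (simp add: emeasure_eq_measure)
  qed
  hence "measure m N = 0" using measure_nonneg[of m N] by linarith
  thus ?thesis using Nb by (auto simp: null_sets_def sets emeasure_eq_measure)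
qed

section \<open>Line coordinate on the circle and the resolvent kernel\<close>

text \<open>The inverse Cayley transform \<open>i (1 + w) / (1 - w)\<close> on the unit circle; the point \<open>w = 1\<close> is
  infinity and gets the junk value 0.\<close>

definition line_coord :: "complex \<Rightarrow> real" where
  "line_coord w = - 2 * Im w / (cmod (1 - w))\<^sup>2"

lemma line_coord:
  fixes w :: complex
  assumes "cmod w = 1" "w \<noteq> 1"
  shows "\<i> * (1 + w) = line_coord w * (1 - w)"
proof -
  have w: "w * cnj w = 1" using assms(1) by (simp add: mult_cnj_eq_cmod)
  have n: "complex_of_real ((cmod (1 - w))\<^sup>2) = (1 - w) * (1 - cnj w)"
    by (simp only: complex_norm_square) simp
  have "\<i> * (1 + w) * complex_of_real ((cmod (1 - w))\<^sup>2) = \<i> * (w - cnj w) * (1 - w)"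
    unfolding n using w by algebra
  also have "\<i> * (w - cnj w) = of_real (- 2 * Im w)" by (simp add: complex_eq_iff)
  finally show ?thesis using assms(2) by (simp add: line_coord_def divide_simps) 
qed

text \<open>The points equidistant from \<open>i\<close> and \<open>-i\<close> form the real
  axis.\<close>

lemma cmod_diff_ne_cmod_add:
  assumes "Im z \<noteq> 0"
  shows "cmod (\<i> - z) \<noteq> cmod (\<i> + z)"
proof
  assume "cmod (\<i> - z) = cmod (\<i> + z)"
  hence "(cmod (\<i> - z))\<^sup>2 = (cmod (\<i> + z))\<^sup>2" by simp
  hence "(Re z)\<^sup>2 + (1 - Im z)\<^sup>2 = (Re z)\<^sup>2 + (1 + Im z)\<^sup>2" unfolding cmod_power2 by simp
  thus False using assms by (simp add: power2_eq_square algebra_simps)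
qed

lemma kern_denominator:
  assumes z: "Im z \<noteq> 0" and w: "cmod w = 1"
  shows "(\<i> - z) + (\<i> + z) * w \<noteq> 0"
proof
  assume "(\<i> - z) + (\<i> + z) * w = 0"
  hence "cmod (\<i> - z) = cmod ((\<i> + z) * w)" by (metis add_eq_0_iff2 norm_minus_cancel)
  thus False using cmod_diff_ne_cmod_add[OF z] w by (simp add: norm_mult)
qed

text \<open>The function \<open>1 / (x - z)\<close> of the line coordinate
  \<open>x = i (1 + w) / (1 - w)\<close>, with the denominator \<open>1 - w\<close> cleared. This
  makes it continuous on the whole circle with value 0 at infinity, whereas the junk value
  \<open>line_coord 1 = 0\<close> would give \<open>-1/z\<close> there.\<close>

definition kern :: "complex \<Rightarrow> complex \<Rightarrow> complex" where
  "kern z w = (1 - w) / ((\<i> - z) + (\<i> + z) * w)"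


lemma kern_eq:
  assumes z: "Im z \<noteq> 0" and w: "cmod w = 1"
  shows "kern z w = (if w = 1 then 0 else 1 / (of_real (line_coord w) - z))"
proof (cases "w = 1")
  case False
  have "(\<i> - z) + (\<i> + z) * w = (of_real (line_coord w) - z) * (1 - w)"
    using line_coord[OF w False] by (simp add: algebra_simps)
  thus ?thesis using False by (simp add: kern_def)
qed (simp add: kern_def)

lemma continuous_on_kern: "Im z \<noteq> 0 \<Longrightarrow> continuous_on (sphere 0 1) (kern z)"
  unfolding kern_def by (intro continuous_intros) (auto simp: kern_denominator)

lemma line_resolvent_parts:
  fixes x l e :: real
  defines "q \<equiv> 1 / (complex_of_real x - Complex l e)"
  shows "Re q = (x - l) / ((x - l)\<^sup>2 + e\<^sup>2)" "Im q = e / ((x - l)\<^sup>2 + e\<^sup>2)"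
  by (simp_all add: q_def Re_divide Im_divide)

section \<open>Borel transform and absolutely continuous vectors\<close>

locale spectral_op = self_adjoint_op D A + spectral_rep "self_adjoint_op.V D A" "self_adjoint_op.W D A" M psi
  for D :: "'a::{complex_inner, complete_space} set" and A M psi
begin

text \<open>The operator form of \<open>kern z w * ((i - z) + (i + z) * w) = 1 - w\<close>, with
  \<open>V\<close> in place of \<open>w\<close> and the resolvent in place of the kernel.\<close>

lemma cayley_resolvent:
  assumes z: "Im z \<noteq> 0"
  shows "scaleC (\<i> - z) (R z x) + scaleC (\<i> + z) (V (R z x)) = x - V x"
proof -
  let ?u = "R z x"
  have "R (-\<i>) x = ?u - scaleC (z + \<i>) (R (-\<i>) ?u)"
    by (rule resolvent_eqI)
      (use z in \<open>auto simp: dom resolvent_dom op_diff op_add op_scaleC op_resolvent scaleC_simps algebra_simps\<close>)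
  hence "x - V x = scaleC (2 * \<i>) ?u - scaleC (2 * \<i> * (z + \<i>)) (R (-\<i>) ?u)"
    by (simp add: V_def scaleC_diff_right scaleC_scaleC)
  also have "2 * \<i> * (z + \<i>) = (\<i> + z) * (2 * \<i>)" by algebra
  also have "scaleC (2 * \<i>) ?u = scaleC (\<i> - z) ?u + scaleC (\<i> + z) ?u"
    by (simp flip: scaleC_add_left)
  finally show ?thesis by (simp add: V_def scaleC_diff_right scaleC_scaleC)
qed

text \<open>\<open>V\<close> preserves norms, so a nonzero kernel vector would force
  \<open>cmod (i - z) = cmod (i + z)\<close>.\<close>

lemma cayley_combination_inj:
  assumes z: "Im z \<noteq> 0" and eq: "scaleC (\<i> - z) u + scaleC (\<i> + z) (V u) = scaleC (\<i> - z) v + scaleC (\<i> + z) (V v)"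
  shows "u = v"
proof -
  have "scaleC (\<i> - z) (u - v) = - scaleC (\<i> + z) (V (u - v))"
    using eq by (simp add: scaleC_simps V_diff algebra_simps)
  hence "cmod (\<i> - z) * norm (u - v) = cmod (\<i> + z) * norm (u - v)"
    by (metis norm_V norm_minus_cancel norm_scaleC)
  thus ?thesis using cmod_diff_ne_cmod_add[OF z] by simp
qed

text \<open>The calculus supplies some vector \<open>y\<close> for \<open>kern z w * f w\<close>; it
  solves the same equation as \<open>R z x\<close> in \<open>cayley_resolvent\<close>, and
  injectivity identifies the two.\<close>

lemma calc_resolvent:
  assumes z: "Im z \<noteq> 0" and f: "calc f x"
  shows "calc (\<lambda>w. kern z w * f w) (R z x)"
proof -
  obtain y where y: "calc (\<lambda>w. kern z w * f w) y"
    using calc_exists[of "\<lambda>w. kern z w * f w"] continuous_on_kern[OF z] calc_continuous[OF f]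
    by (auto intro: continuous_on_mult)
  have "scaleC (\<i> - z) y + scaleC (\<i> + z) (V y) = x - V x"
  proof (rule calc_unique[OF calc_add[OF calc_scale[OF y] calc_scale[OF calc_V[OF y]]] calc_diff[OF f calc_V[OF f]]])
    fix w assume "w \<in> circle"
    hence k: "kern z w * ((\<i> - z) + (\<i> + z) * w) = 1 - w"
      unfolding kern_def using kern_denominator[OF z, of w] by simp
    have "(\<i> - z) * (kern z w * f w) + (\<i> + z) * (w * (kern z w * f w))
        = kern z w * ((\<i> - z) + (\<i> + z) * w) * f w" by (simp only: algebra_simps)
    also have "\<dots> = f w - w * f w" unfolding k by (simp add: algebra_simps)
    finally show "(\<i> - z) * (kern z w * f w) + (\<i> + z) * (w * (kern z w * f w)) = f w - w * f w" .
  qed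
  hence "scaleC (\<i> - z) y + scaleC (\<i> + z) (V y) = scaleC (\<i> - z) (R z x) + scaleC (\<i> + z) (V (R z x))"
    by (simp only: cayley_resolvent[OF z])
  hence "y = R z x" by (rule cayley_combination_inj[OF z])
  with y show ?thesis by simp
qed

lemma borel_transform: "Im z \<noteq> 0 \<Longrightarrow> cinner psi (R z psi) = cint (kern z)"
  using cinner_calc[OF calc_one calc_resolvent[OF _ calc_one]] by simp

lemma measurable_cis [measurable]: "cis \<in> borel_measurable borel"
  by (intro borel_measurable_continuous_onI continuous_intros)

lemma measurable_line_coord [measurable]: "(\<lambda>t. line_coord (cis t)) \<in> borel_measurable borel"
  unfolding line_coord_def by measurable

text \<open>The condition \<open>cis t \<noteq> 1\<close> keeps the point at infinity from being
  counted at 0, its junk coordinate.\<close>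

definition line_part :: "real set \<Rightarrow> real set" where
  "line_part S = {t. cis t \<noteq> 1 \<and> line_coord (cis t) \<in> S}"

lemma measurable_line_part:
  assumes [measurable]: "S \<in> sets borel"
  shows "line_part S \<in> sets borel"
  unfolding line_part_def by measurable

lemma integrable_kern: "Im z \<noteq> 0 \<Longrightarrow> integrable M (\<lambda>t. kern z (cis t))"
  by (intro integrable_circle continuous_on_kern)

lemma Im_kern: "0 < e \<Longrightarrow> Im (kern (Complex l e) (cis t))
    = (if cis t = 1 then 0 else e / ((line_coord (cis t) - l)\<^sup>2 + e\<^sup>2))"
  by (simp add: kern_eq line_resolvent_parts)

lemma Re_kern: "0 < e \<Longrightarrow> Re (kern (Complex l e) (cis t))
    = (if cis t = 1 then 0 else (line_coord (cis t) - l) / ((line_coord (cis t) - l)\<^sup>2 + e\<^sup>2))"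
  by (simp add: kern_eq line_resolvent_parts)

text \<open>The imaginary part of the kernel is the Poisson kernel
  \<open>e / ((x - l)^2 + e^2)\<close>, which is at least \<open>1 / (2 e)\<close> on the ball of
  radius \<open>e\<close>; its integral is the imaginary part of the Borel transform.\<close>

lemma measure_line_part_cball_le:
  assumes e: "0 < e" and B: "cmod (cinner psi (R (Complex l e) psi)) \<le> B"
  shows "measure M (line_part (cball l e)) \<le> 2 * B * e"
proof -
  have S[measurable]: "line_part (cball l e) \<in> sets M" by (simp add: measurable_line_part)
  have "measure M (line_part (cball l e)) / (2 * e) = (\<integral>t. indicator (line_part (cball l e)) t / (2 * e) \<partial>M)"
    using S sets.sets_into_space[OF S] by (simp add: Int_absorb2)
  also have "\<dots> \<le> (\<integral>t. Im (kern (Complex l e) (cis t)) \<partial>M)"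
  proof (rule integral_mono)
    show "integrable M (\<lambda>t. indicator (line_part (cball l e)) t / (2 * e))"
      by (intro integrable_divide M.integrable_const_bound[of _ 1]) (auto simp: indicator_def)
    show "integrable M (\<lambda>t. Im (kern (Complex l e) (cis t)))"
      using e by (intro integrable_Im integrable_kern) simp
    show "indicator (line_part (cball l e)) t / (2 * e) \<le> Im (kern (Complex l e) (cis t))" for t
    proof (cases "t \<in> line_part (cball l e)")
      case True
      hence "(line_coord (cis t) - l)\<^sup>2 \<le> e\<^sup>2"
        using e by (intro power2_le_iff_abs_le[THEN iffD2]) (auto simp: line_part_def dist_real_def)
      hence "e / (2 * e\<^sup>2) \<le> e / ((line_coord (cis t) - l)\<^sup>2 + e\<^sup>2)"
        using e by (intro divide_left_mono) (auto simp: add_nonneg_pos)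
      thus ?thesis using True e by (simp add: Im_kern line_part_def power2_eq_square)
    next
      case False
      thus ?thesis using e by (simp add: Im_kern add_nonneg_pos)
    qed
  qed
  also have "\<dots> = Im (cinner psi (R (Complex l e) psi))"
    using e by (simp add: borel_transform integrable_kern)
  also have "\<dots> \<le> B" using B abs_Im_le_cmod[of "cinner psi (R (Complex l e) psi)"] by linarith
  finally show ?thesis using e by (simp add: field_simps)
qed


lemma norm_calc:
  assumes f: "calc f x"
  shows "(norm x)\<^sup>2 = (\<integral>t. (cmod (f (cis t)))\<^sup>2 \<partial>M)"
proof -
  have "complex_of_real ((norm x)\<^sup>2) = cint (\<lambda>w. cnj (f w) * f w)"
    by (simp only: cinner_calc[OF f f, symmetric] cinner_self)
  also have "\<dots> = cint (\<lambda>w. complex_of_real ((cmod (f w))\<^sup>2))"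
    by (simp only: complex_norm_square mult.commute)
  also have "\<dots> = complex_of_real (\<integral>t. (cmod (f (cis t)))\<^sup>2 \<partial>M)"
    by (rule integral_complex_of_real)
  finally show ?thesis by (simp only: of_real_eq_iff)
qed

lemma integrable_calc_norm: "calc f x \<Longrightarrow> integrable M (\<lambda>t. (cmod (f (cis t)))\<^sup>2)"
  by (intro integrable_circle[of "\<lambda>w. (cmod (f w))\<^sup>2"] continuous_intros calc_continuous)

lemma norm_calc_le:
  assumes f: "calc f x" and g: "calc g y" and d: "0 \<le> d"
    and le: "\<And>w. w \<in> circle \<Longrightarrow> cmod (f w) \<le> d * cmod (g w)"
  shows "norm x \<le> d * norm y"
proof (rule power2_le_imp_le)
  have "(norm x)\<^sup>2 \<le> (\<integral>t. d\<^sup>2 * (cmod (g (cis t)))\<^sup>2 \<partial>M)"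
    unfolding norm_calc[OF f]
  proof (intro integral_mono integrable_calc_norm[OF f] integrable_mult_right integrable_calc_norm[OF g])
    show "(cmod (f (cis t)))\<^sup>2 \<le> d\<^sup>2 * (cmod (g (cis t)))\<^sup>2" for t
      using power_mono[OF le[of "cis t"], of 2] by (simp add: power_mult_distrib)
  qed
  thus "(norm x)\<^sup>2 \<le> (d * norm y)\<^sup>2" by (simp add: norm_calc[OF g] power_mult_distrib)
qed (use d in simp)

text \<open>Without mass in \<open>(a,b)\<close> the imaginary part of the Borel transform is
  \<open>O(e)\<close> there, so \<open>bound\<close> forces the real boundary value to be
  \<open>1 / kappa\<close> at every point of the interval. Two points of the interval then
  contradict monotonicity.\<close>

lemma line_part_nonnull:
  assumes ab: "a < b" and e0: "0 < e0" and K: "0 \<le> K"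
    and bound: "\<And>l e. a < l \<Longrightarrow> l < b \<Longrightarrow> 0 < e \<Longrightarrow> e < e0 \<Longrightarrow>
      (cmod (1 - of_real kappa * cinner psi (R (Complex l e) psi)))\<^sup>2 \<le> K * Im (cinner psi (R (Complex l e) psi))"
  shows "measure M (line_part {a<..<b}) \<noteq> 0"
proof
  assume "measure M (line_part {a<..<b}) = 0"
  hence "line_part {a<..<b} \<in> null_sets M"
    by (auto simp: null_sets_def M.emeasure_eq_measure measurable_line_part)
  hence AE: "AE t in M. cis t = 1 \<or> line_coord (cis t) \<notin> {a<..<b}"
    by (drule_tac AE_not_in) (auto simp: line_part_def)
  define g where "g l t = (if cis t = 1 then 0 else 1 / (line_coord (cis t) - l))" for l t
  have gM [measurable]: "g l \<in> borel_measurable M" for l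
    unfolding g_def by (simp add: measurable_cong_sets[OF M.events_eq_borel refl]) measurable
  have main: "integrable M (g l) \<and> 1 - kappa * (\<integral>t. g l t \<partial>M) = 0" if l: "a < l" "l < b" for l
  proof -
    \<comment> \<open>Almost all finite line coordinates keep distance at least \<open>h\<close>
      from \<open>l\<close>, which gives integrability and a dominating constant
      \<open>1 / h\<close>.\<close>
    define h where "h = min (l - a) (b - l)"
    have h: "0 < h" using l by (simp add: h_def)
    have AEh: "AE t in M. cis t = 1 \<or> h \<le> \<bar>line_coord (cis t) - l\<bar>"
      using AE by eventually_elim (auto simp: h_def)
    define e where "e j = e0 / real (j + 2)" for j :: nat
    have e: "0 < e j" "e j < e0" for j using e0 by (auto simp: e_def field_simps intro!: add_pos_nonneg)
    have e_lim: "e \<longlonglongrightarrow> 0" unfolding e_def by real_asymp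
    let ?G = "\<lambda>j. cinner psi (R (Complex l (e j)) psi)"
    have G: "?G j = cint (kern (Complex l (e j)))" for j
      using e[of j] by (intro borel_transform) simp
    have intk: "integrable M (\<lambda>t. kern (Complex l (e j)) (cis t))" for j
      using e[of j] by (intro integrable_kern) simp
    have ImG: "Im (?G j) \<le> e j / h\<^sup>2" for j
    proof -
      have "Im (?G j) = (\<integral>t. Im (kern (Complex l (e j)) (cis t)) \<partial>M)" using intk by (simp add: G)
      also have "\<dots> \<le> (\<integral>t. e j / h\<^sup>2 \<partial>M)"
      proof (intro integral_mono_AE integrable_Im intk)
        show "AE t in M. Im (kern (Complex l (e j)) (cis t)) \<le> e j / h\<^sup>2"
          using AEh
        proof eventually_elim
          case (elim t)
          show ?case
          proof (cases "cis t = 1")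
            case False
            hence "h\<^sup>2 \<le> (line_coord (cis t) - l)\<^sup>2" using elim h by (simp add: abs_le_square_iff[symmetric])
            hence "h\<^sup>2 \<le> (line_coord (cis t) - l)\<^sup>2 + (e j)\<^sup>2" by (simp add: add_increasing2)
            thus ?thesis using False e(1)[of j] h
              by (simp add: Im_kern) (intro divide_left_mono, auto intro!: mult_pos_pos simp: add_nonneg_pos)
          qed (use e(1)[of j] in \<open>simp add: kern_def\<close>)
        qed
      qed simp
      finally show ?thesis using M.prob_space by simp
    qed
    have gle: "AE t in M. norm (g l t) \<le> 1 / h"
      using AEh by eventually_elim (use h in \<open>auto simp: g_def field_simps\<close>)
    have int: "integrable M (g l)" by (rule M.integrable_const_bound[OF gle]) measurable
    have "(\<lambda>j. (1 - kappa * Re (?G j))\<^sup>2) \<longlonglongrightarrow> 0"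
    proof (rule tendsto_sandwich[of "\<lambda>_. 0"])
      show "(\<lambda>j. K * (e j / h\<^sup>2)) \<longlonglongrightarrow> 0"
        using tendsto_mult[OF tendsto_const[of K] tendsto_divide[OF e_lim tendsto_const[of "h\<^sup>2"]]] h by simp
      have "(1 - kappa * Re (?G j))\<^sup>2 \<le> K * (e j / h\<^sup>2)" for j
      proof -
        have "(1 - kappa * Re (?G j))\<^sup>2 = (Re (1 - of_real kappa * ?G j))\<^sup>2" by simp
        also have "\<dots> \<le> (cmod (1 - of_real kappa * ?G j))\<^sup>2" unfolding cmod_power2 by simp
        also have "\<dots> \<le> K * Im (?G j)" by (intro bound l e)
        also have "\<dots> \<le> K * (e j / h\<^sup>2)" using K ImG by (intro mult_left_mono)
        finally show ?thesis .
      qed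
      thus "\<forall>\<^sub>F j in sequentially. (1 - kappa * Re (?G j))\<^sup>2 \<le> K * (e j / h\<^sup>2)" by simp
    qed auto
    moreover have "(\<lambda>j. Re (?G j)) \<longlonglongrightarrow> (\<integral>t. g l t \<partial>M)"
    proof -
      have "(\<lambda>j. \<integral>t. Re (kern (Complex l (e j)) (cis t)) \<partial>M) \<longlonglongrightarrow> (\<integral>t. g l t \<partial>M)"
      proof (rule integral_dominated_convergence[of _ _ _ "\<lambda>_. 1 / h"])
        show "(\<lambda>t. Re (kern (Complex l (e j)) (cis t))) \<in> borel_measurable M" for j
          by (intro borel_measurable_integrable integrable_Re intk)
        show "AE t in M. (\<lambda>j. Re (kern (Complex l (e j)) (cis t))) \<longlonglongrightarrow> g l t"
          using AEh
        proof eventually_elim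
          case (elim t)
          show ?case
          proof (cases "cis t = 1")
            case False
            let ?d = "line_coord (cis t) - l"
            have d: "?d \<noteq> 0" using elim h False by auto
            have "(\<lambda>j. ?d / (?d\<^sup>2 + (e j)\<^sup>2)) \<longlonglongrightarrow> ?d / (?d\<^sup>2 + 0\<^sup>2)"
              using d by (intro tendsto_intros e_lim) auto
            thus ?thesis using False d e by (simp add: Re_kern g_def power2_eq_square)
          qed (simp add: kern_def g_def)
        qed
        show "AE t in M. norm (Re (kern (Complex l (e j)) (cis t))) \<le> 1 / h" for j
          using AEh
        proof eventually_elim
          case (elim t)
          show ?case
          proof (cases "cis t = 1")
            case False
            let ?d = "line_coord (cis t) - l"
            have d: "h \<le> \<bar>?d\<bar>" using elim False by auto
            hence "h * \<bar>?d\<bar> \<le> \<bar>?d\<bar> * \<bar>?d\<bar>" by (intro mult_right_mono) auto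
            hence "h * \<bar>?d\<bar> \<le> ?d\<^sup>2 + (e j)\<^sup>2" by (simp add: power2_eq_square add_increasing2)
            moreover have "0 < ?d\<^sup>2 + (e j)\<^sup>2" using e(1)[of j] by (simp add: add_nonneg_pos)
            ultimately have "\<bar>?d\<bar> / (?d\<^sup>2 + (e j)\<^sup>2) \<le> 1 / h" using h by (simp add: divide_simps mult.commute)
            thus ?thesis using False e by (simp add: Re_kern abs_divide)
          qed (use h in \<open>simp add: kern_def\<close>)
        qed
      qed auto
      thus ?thesis using intk by (simp add: G)
    qed
    hence "(\<lambda>j. (1 - kappa * Re (?G j))\<^sup>2) \<longlonglongrightarrow> (1 - kappa * (\<integral>t. g l t \<partial>M))\<^sup>2"
      by (intro tendsto_intros)
    ultimately have "(1 - kappa * (\<integral>t. g l t \<partial>M))\<^sup>2 = 0" using LIMSEQ_unique by blast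
    thus ?thesis using int by simp
  qed
  define l1 l2 where "l1 = a + (b - a) / 3" and "l2 = a + 2 * (b - a) / 3"
  have l: "a < l1" "l1 < l2" "l2 < b" using ab by (auto simp: l1_def l2_def field_simps)
  have l1: "integrable M (g l1)" "1 - kappa * (\<integral>t. g l1 t \<partial>M) = 0" using main[of l1] l by auto
  have l2: "integrable M (g l2)" "1 - kappa * (\<integral>t. g l2 t \<partial>M) = 0" using main[of l2] l by auto
  have pos: "0 < 1 / (x - l2) - 1 / (x - l1)" if "x \<notin> {a<..<b}" for x
  proof -
    have "0 < (x - l1) * (x - l2)"
      using that l by (cases "x \<le> a") (auto intro: mult_pos_pos mult_neg_neg)
    moreover from this have "x - l1 \<noteq> 0" "x - l2 \<noteq> 0" by auto
    hence "1 / (x - l2) - 1 / (x - l1) = (l2 - l1) / ((x - l1) * (x - l2))"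
      by (simp add: field_simps)
    ultimately show ?thesis using l by simp
  qed
  have "kappa * (\<integral>t. g l2 t \<partial>M) = kappa * (\<integral>t. g l1 t \<partial>M)" "kappa \<noteq> 0"
    using l1(2) l2(2) by auto
  hence "(\<integral>t. g l2 t - g l1 t \<partial>M) = 0" using l1(1) l2(1) by simp
  moreover have "AE t in M. 0 \<le> g l2 t - g l1 t"
    using AE by eventually_elim (use pos less_imp_le in \<open>auto simp: g_def\<close>)
  \<comment> \<open>The difference is strictly positive at every finite coordinate outside
    \<open>(a,b)\<close>, so almost all mass would sit at infinity. There \<open>g l1\<close> is 0,
    and the boundary equation collapses to \<open>1 = 0\<close>.\<close>
  ultimately have "AE t in M. g l2 t - g l1 t = 0"
    using integral_nonneg_eq_0_iff_AE[of M "\<lambda>t. g l2 t - g l1 t"] l1(1) l2(1) by simp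
  hence "AE t in M. g l1 t = 0"
    using AE
  proof eventually_elim
    case (elim t)
    thus ?case using pos[of "line_coord (cis t)"] by (auto simp: g_def)
  qed
  hence "(\<integral>t. g l1 t \<partial>M) = 0" by (rule integral_eq_zero_AE)
  with l1(2) show False by simp
qed


text \<open>The Poisson estimate gives intervals around points of \<open>[a,b]\<close> mass
  \<open>O(length)\<close>; the Vitali argument applies to the push-forward of \<open>M\<close> to
  the line.\<close>

lemma line_part_null:
  assumes e0: "0 < e0"
    and bound: "\<And>l e. a \<le> l \<Longrightarrow> l \<le> b \<Longrightarrow> 0 < e \<Longrightarrow> e < e0 \<Longrightarrow> cmod (cinner psi (R (Complex l e) psi)) \<le> B"
    and N: "N \<in> null_sets lborel" "N \<subseteq> {a..b}"
  shows "line_part N \<in> null_sets M"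
proof (cases "a \<le> b")
  case ab: True
  \<comment> \<open>The atom of \<open>M\<close> at \<open>w = 1\<close>, the point at infinity, is parked outside \<open>{a..b}\<close>.\<close>
  define Y where "Y t = (if cis t = 1 then b + 1 else line_coord (cis t))" for t
  have Y [measurable]: "Y \<in> M \<rightarrow>\<^sub>M borel"
    unfolding Y_def by (simp add: measurable_cong_sets[OF M.events_eq_borel refl]) measurable
  have em: "emeasure (distr M borel Y) S = emeasure M (line_part S)" if "S \<in> sets borel" "b + 1 \<notin> S" for S
  proof -
    have "Y -` S \<inter> space M = line_part S" using that(2) by (auto simp: Y_def line_part_def split: if_splits)
    thus ?thesis using that(1) by (simp add: emeasure_distr)
  qed
  have B0: "0 \<le> B" using bound[of a "e0/2"] ab e0 by (intro order_trans[OF norm_ge_zero]) auto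
  have "N \<in> null_sets (distr M borel Y)"
  \<comment> \<open>Radii below 1 keep balls centred in \<open>[a,b]\<close> away from the parked
    atom at \<open>b + 1\<close>.\<close>
  proof (rule null_set_if_cball_bound[where C = "2 * B" and rmax = "min e0 1" and S = "{a..b}"])
    show "finite_measure (distr M borel Y)" by (intro M.finite_measure_distr) simp
    fix l e assume l: "l \<in> {a..b}" and e: "0 < e" "e < min e0 1"
    have "measure (distr M borel Y) (cball l e) = measure M (line_part (cball l e))"
      unfolding measure_def using l e by (subst em) (auto simp: dist_real_def)
    also have "\<dots> \<le> 2 * B * e" using l e by (intro measure_line_part_cball_le bound) auto
    finally show "measure (distr M borel Y) (cball l e) \<le> 2 * B * e" .
  qed (use e0 B0 N in auto)
  moreover have Nb: "N \<in> sets borel" using N by (auto simp: null_sets_def)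
  moreover have "b + 1 \<notin> N" using N by auto
  ultimately show ?thesis using em[of N] by (auto simp: null_sets_def measurable_line_part)
next
  case False
  hence "N = {}" using N by auto
  thus ?thesis by (simp add: line_part_def)
qed

text \<open>The spectral measure of \<open>f(V) psi\<close> is the density \<open>|f|^2\<close>
  times \<open>M\<close>, pushed to the line. Since \<open>supp\<close> makes \<open>f\<close>
  vanish at infinity and outside \<open>S\<close>, the push-forward loses nothing and only null sets
  within \<open>S\<close> matter.\<close>

lemma ac_subspaceI:
  assumes f: "calc f phi" and supp: "\<And>t. f (cis t) \<noteq> 0 \<Longrightarrow> t \<in> line_part S" and S: "S \<in> sets borel"
    and null: "\<And>N. N \<in> null_sets lborel \<Longrightarrow> N \<subseteq> S \<Longrightarrow> line_part N \<in> null_sets M"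
  shows "phi \<in> ac_subspace D A"
proof -
  define X where "X t = line_coord (cis t)" for t
  have X [measurable]: "X \<in> M \<rightarrow>\<^sub>M borel"
    unfolding X_def by (simp add: measurable_cong_sets[OF M.events_eq_borel refl])
  define d where "d t = (cmod (f (cis t)))\<^sup>2" for t
  have int_d: "integrable M d" unfolding d_def by (rule integrable_calc_norm[OF f])
  hence d [measurable]: "d \<in> borel_measurable M" by simp
  define nu where "nu = distr (density M (\<lambda>t. ennreal (d t))) borel X"
  have emnu: "emeasure nu N = (\<integral>\<^sup>+t. ennreal (d t) * indicator (X -` N \<inter> space M) t \<partial>M)" if "N \<in> sets borel" for N
  proof -
    have "emeasure nu N = emeasure (density M (\<lambda>t. ennreal (d t))) (X -` N \<inter> space M)"
      using that unfolding nu_def by (subst emeasure_distr) auto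
    also have "\<dots> = (\<integral>\<^sup>+t. ennreal (d t) * indicator (X -` N \<inter> space M) t \<partial>M)"
      by (intro emeasure_density measurable_sets[OF X that]) simp
    finally show ?thesis .
  qed
  have "finite_measure nu"
  proof
    have "emeasure nu (space nu) = (\<integral>\<^sup>+t. ennreal (d t) \<partial>M)"
      using emnu[of UNIV] by (simp add: nu_def)
    also have "\<dots> = ennreal (\<integral>t. d t \<partial>M)" by (intro nn_integral_eq_integral int_d) (simp add: d_def)
    finally show "emeasure nu (space nu) \<noteq> \<infinity>" by simp
  qed
  moreover have "absolutely_continuous lborel nu"
    unfolding absolutely_continuous_def
  proof
    fix N :: "real set" assume N: "N \<in> null_sets lborel"
    hence Nb: "N \<in> sets borel" by (auto simp: null_sets_def)
    have "N \<inter> S \<in> null_sets lborel" using N S by (intro null_set_Int2) auto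
    hence "line_part (N \<inter> S) \<in> null_sets M" by (rule null) auto
    hence "AE t in M. t \<notin> line_part (N \<inter> S)" by (rule AE_not_in)
    hence "AE t in M. ennreal (d t) * indicator (X -` N \<inter> space M) t = 0"
    proof eventually_elim
      case (elim t)
      show ?case
      proof (cases "f (cis t) = 0")
        case False
        with supp have "t \<in> line_part S" by blast
        with elim show ?thesis by (auto simp: line_part_def X_def)
      qed (simp add: d_def)
    qed
    hence "emeasure nu N = 0"
      unfolding emnu[OF Nb] by (subst nn_integral_0_iff_AE) (use Nb in auto)
    thus "N \<in> null_sets nu" using Nb by (auto simp: nu_def null_sets_def)
  qed
  moreover have "cinner phi (R z phi) = (\<integral>x. 1 / (complex_of_real x - z) \<partial>nu)" if z: "Im z \<noteq> 0" for z
  proof -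
    have [measurable]: "(\<lambda>x. 1 / (complex_of_real x - z)) \<in> borel_measurable borel" by measurable
    have "cinner phi (R z phi) = cint (\<lambda>w. cnj (f w) * (kern z w * f w))"
      by (rule cinner_calc[OF f calc_resolvent[OF z f]])
    also have "\<dots> = (\<integral>t. d t *\<^sub>R (1 / (complex_of_real (X t) - z)) \<partial>M)"
    proof (intro Bochner_Integration.integral_cong refl)
      fix t
      show "cnj (f (cis t)) * (kern z (cis t) * f (cis t)) = d t *\<^sub>R (1 / (complex_of_real (X t) - z))"
      proof (cases "f (cis t) = 0")
        case False
        with supp have "cis t \<noteq> 1" by (auto simp: line_part_def)
        hence "kern z (cis t) = 1 / (complex_of_real (X t) - z)" by (simp add: kern_eq[OF z] X_def)
        moreover have "complex_of_real (d t) = f (cis t) * cnj (f (cis t))"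
          unfolding d_def by (rule complex_norm_square)
        ultimately show ?thesis by (simp add: scaleR_conv_of_real)
      qed (simp add: d_def)
    qed
    also have "\<dots> = (\<integral>t. 1 / (complex_of_real (X t) - z) \<partial>density M (\<lambda>t. ennreal (d t)))"
      by (intro integral_density[symmetric] d) (auto simp: d_def)
    also have "\<dots> = (\<integral>x. 1 / (complex_of_real x - z) \<partial>nu)"
      unfolding nu_def by (intro integral_distr[symmetric]) auto
    finally show ?thesis .
  qed
  ultimately show ?thesis
    unfolding ac_subspace_def is_spectral_measure_def
    by (intro CollectI exI[of _ nu]) (auto simp: nu_def)
qed

text \<open>On \<open>f(V) psi\<close> with \<open>f\<close> supported over \<open>(a,b)\<close>,
  the operator \<open>A - l0\<close> multiplies by the line coordinate minus \<open>l0\<close>,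
  which is at most \<open>d\<close> in modulus there.\<close>

lemma ac_approximate_eigenvector:
  assumes ab: "a < b" and e0: "0 < e0" and d: "0 \<le> d"
    and bound: "\<And>l e. a \<le> l \<Longrightarrow> l \<le> b \<Longrightarrow> 0 < e \<Longrightarrow> e < e0 \<Longrightarrow> cmod (cinner psi (R (Complex l e) psi)) \<le> B"
    and nonnull: "measure M (line_part {a<..<b}) \<noteq> 0"
    and near: "\<And>x. a < x \<Longrightarrow> x < b \<Longrightarrow> \<bar>x - l0\<bar> \<le> d"
  shows "\<exists>phi\<in>D \<inter> ac_subspace D A. phi \<noteq> 0 \<and> norm (A phi - scaleC (complex_of_real l0) phi) \<le> d * norm phi"
proof -
  define c r where "c = (a + b) / 2" and "r = (b - a) / 2"
  have cr: "a = c - r" "b = c + r" by (simp_all add: c_def r_def field_simps)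
  \<comment> \<open>The tent \<open>max 0 (r - |x - c|)\<close> in the line coordinate
    \<open>x\<close>, multiplied by \<open>cmod (1 - w)\<close>: with the denominator cleared it is
    evidently continuous at \<open>w = 1\<close>, and it vanishes there.\<close>
  define g where "g w = complex_of_real (max 0 (r * cmod (1 - w) - cmod (\<i> * (1 + w) - of_real c * (1 - w))))" for w
  \<comment> \<open>The extra factor \<open>1 - w\<close> brings the vector into the domain, since
    \<open>y - V y = 2 i R (-i) y\<close>.\<close>
  define f where "f w = g w - w * g w" for w
  have g_nz: "g w \<noteq> 0 \<longleftrightarrow> w \<noteq> 1 \<and> line_coord w \<in> {a<..<b}" if w: "cmod w = 1" for w
  proof (cases "w = 1")
    case False
    have "\<i> * (1 + w) - of_real c * (1 - w) = of_real (line_coord w - c) * (1 - w)"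
      unfolding line_coord[OF w False] by (simp add: algebra_simps)
    hence "g w = of_real (max 0 ((r - \<bar>line_coord w - c\<bar>) * cmod (1 - w)))"
      unfolding g_def by (simp only: norm_mult norm_of_real) (simp only: algebra_simps)
    moreover have "max 0 p \<noteq> 0 \<longleftrightarrow> 0 < p" for p :: real by (auto simp: max_def)
    ultimately have "g w \<noteq> 0 \<longleftrightarrow> 0 < (r - \<bar>line_coord w - c\<bar>) * cmod (1 - w)"
      by (simp only: of_real_eq_0_iff)
    also have "\<dots> \<longleftrightarrow> 0 < r - \<bar>line_coord w - c\<bar>" using False by (simp add: zero_less_mult_iff)
    also have "\<dots> \<longleftrightarrow> line_coord w \<in> {a<..<b}"
      unfolding cr by (auto simp: abs_if split: if_splits)
    finally show ?thesis using False by simp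
  qed (simp add: g_def)
  have f_eq: "f w = (1 - w) * g w" for w by (simp add: f_def algebra_simps)
  have "continuous_on circle g" unfolding g_def by (intro continuous_intros)
  then obtain y where y: "calc g y" using calc_exists by blast
  define phi where "phi = y - V y"
  have phi: "calc f phi" unfolding f_def phi_def by (intro calc_diff calc_V y)
  define u where "u = R (-\<i>) y"
  have u: "u \<in> D" "A u = y - scaleC \<i> u" by (simp_all add: u_def resolvent_dom op_resolvent scaleC_minus_left)
  have phi_u: "phi = scaleC (2 * \<i>) u" by (simp add: phi_def u_def V_def)
  have D: "phi \<in> D" unfolding phi_u by (intro dom u)
  \<comment> \<open>With \<open>A u = y - i u\<close> this is \<open>2 i y - i (y - V y)\<close>,
    the vector of \<open>i (1 + w) g(w)\<close>.\<close>
  have "A phi = scaleC \<i> (y + V y)"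
  proof -
    have "A phi = scaleC (2 * \<i>) y - scaleC (2 * \<i>) (scaleC \<i> u)"
      unfolding phi_u by (simp add: op_scaleC u scaleC_diff_right)
    also have "scaleC (2 * \<i>) (scaleC \<i> u) = scaleC \<i> phi" by (simp add: phi_u scaleC_scaleC mult.commute)
    finally show ?thesis by (simp add: phi_def scaleC_double scaleC_simps)
  qed
  hence Aphi: "calc (\<lambda>w. \<i> * (g w + w * g w) - of_real l0 * f w) (A phi - scaleC (of_real l0) phi)"
    by (simp only:) (intro calc_diff calc_scale calc_add calc_V y phi)
  have "norm (A phi - scaleC (of_real l0) phi) \<le> d * norm phi"
  proof (rule norm_calc_le[OF Aphi phi d])
    fix w assume "w \<in> circle"
    hence w: "cmod w = 1" by simp
    show "cmod (\<i> * (g w + w * g w) - of_real l0 * f w) \<le> d * cmod (f w)"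
    proof (cases "g w = 0")
      case False
      hence w1: "w \<noteq> 1" and l: "a < line_coord w" "line_coord w < b" using g_nz[OF w] by auto
      have "\<i> * (g w + w * g w) - of_real l0 * f w = (\<i> * (1 + w) - of_real l0 * (1 - w)) * g w"
        by (simp add: f_eq algebra_simps)
      also have "\<dots> = of_real (line_coord w - l0) * f w"
        unfolding line_coord[OF w w1] by (simp add: f_eq algebra_simps)
      finally show ?thesis using near[OF l] by (simp only: norm_mult norm_of_real) (intro mult_right_mono, auto)
    qed (simp add: f_eq)
  qed
  moreover have "phi \<noteq> 0"
  proof
    assume "phi = 0"
    hence "(\<integral>t. (cmod (f (cis t)))\<^sup>2 \<partial>M) = 0" using norm_calc[OF phi] by simp
    hence "AE t in M. (cmod (f (cis t)))\<^sup>2 = 0"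
      using integral_nonneg_eq_0_iff_AE[OF integrable_calc_norm[OF phi]] by simp
    hence "AE t in M. t \<notin> line_part {a<..<b}"
    proof eventually_elim
      case (elim t)
      thus ?case using g_nz[of "cis t"] by (auto simp: f_eq line_part_def)
    qed
    hence "line_part {a<..<b} \<in> null_sets M"
      by (subst (asm) AE_iff_null) (auto simp: measurable_line_part)
    thus False using nonnull by (auto simp: null_sets_def M.emeasure_eq_measure)
  qed
  moreover have "phi \<in> ac_subspace D A"
  proof (rule ac_subspaceI[OF phi, of "{a<..<b}"])
    show "t \<in> line_part {a<..<b}" if "f (cis t) \<noteq> 0" for t
      using that g_nz[of "cis t"] by (auto simp: f_eq line_part_def)
    show "line_part N \<in> null_sets M" if "N \<in> null_sets lborel" "N \<subseteq> {a<..<b}" for N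
      by (rule line_part_null[OF e0 bound that(1)]) (use that in auto)
  qed simp
  ultimately show ?thesis using D by blast
qed

end

section \<open>Continuity of the resolvent in the energy and the rank-one perturbation
  formula\<close>

context self_adjoint_op begin

text \<open>The resolvent identity bounds the increment by a constant times \<open>|k - l|\<close>,
  the constant depending on \<open>e\<close>. This supplies the continuity that the Baire argument
  asks for.\<close>

lemma continuous_cinner_resolvent:
  assumes e: "0 < e"
  shows "continuous_on UNIV (\<lambda>l. cinner psi (R (Complex l e) psi))"
  unfolding continuous_on_def
proof
  fix l :: real
  have Im: "Im (Complex k e) \<noteq> 0" for k using e by simp
  have le: "cmod (cinner psi (R (Complex k e) psi) - cinner psi (R (Complex l e) psi))
      \<le> \<bar>k - l\<bar> * (norm psi * (norm (R (Complex l e) psi) / e))" for k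
  proof -
    let ?v = "R (Complex k e) (R (Complex l e) psi)"
    have "cinner psi (R (Complex k e) psi) - cinner psi (R (Complex l e) psi) = of_real (k - l) * cinner psi ?v"
      unfolding cinner_diff_right[symmetric] resolvent_identity[OF Im Im] cinner_scaleC_right
      by (simp add: complex_eq_iff)
    moreover have "cmod (cinner psi ?v) \<le> norm psi * (norm (R (Complex l e) psi) / e)"
      using norm_resolvent[OF Im, of k "R (Complex l e) psi"] e
      by (intro order_trans[OF cinner_Cauchy_Schwarz] mult_left_mono) (simp_all add: field_simps)
    ultimately show ?thesis by (simp only: norm_mult norm_of_real) (rule mult_left_mono, simp_all)
  qed
  have "((\<lambda>k. cinner psi (R (Complex k e) psi) - cinner psi (R (Complex l e) psi)) \<longlongrightarrow> 0) (at l)"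
  proof (rule Lim_null_comparison)
    have "((\<lambda>k. \<bar>k - l\<bar> * c) \<longlongrightarrow> \<bar>l - l\<bar> * c) (at l)" for c by (intro tendsto_intros)
    thus "((\<lambda>k. \<bar>k - l\<bar> * (norm psi * (norm (R (Complex l e) psi) / e))) \<longlongrightarrow> 0) (at l)"
      by (simp only: diff_self abs_zero mult_zero_left)
  qed (intro always_eventually allI le)
  thus "((\<lambda>k. cinner psi (R (Complex k e) psi)) \<longlongrightarrow> cinner psi (R (Complex l e) psi)) (at l)"
    by (simp add: LIM_zero_iff)
qed

text \<open>The perturbed operator minus \<open>z\<close> sends \<open>R z psi\<close> to
  \<open>(1 + kappa F) psi\<close>. Applying the perturbed resolvent and pairing with
  \<open>psi\<close> gives \<open>(1 + kappa F) G = F\<close>.\<close>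

lemma rank_one_krein:
  fixes kappa :: real and psi :: 'a
  assumes z: "Im z \<noteq> 0"
  defines "F \<equiv> cinner psi (R z psi)"
    and "G \<equiv> cinner psi (resolvent D (rank_one_pert A kappa psi) z psi)"
  shows "(1 - of_real kappa * G) * (1 + of_real kappa * F) = 1"
proof -
  interpret B: self_adjoint_op D "rank_one_pert A kappa psi"
    by unfold_locales (rule self_adjoint_rank_one_pert)
  have "B.R z (scaleC (1 + of_real kappa * F) psi) = R z psi"
    by (rule B.resolvent_eqI[OF z resolvent_dom[OF z]])
      (simp add: rank_one_pert_def op_resolvent[OF z] F_def[symmetric] scaleC_simps)
  hence G: "(1 + of_real kappa * F) * G = F"
    unfolding B.resolvent_scaleC[OF z] F_def G_def by (metis cinner_scaleC_right)
  have "(1 - of_real kappa * G) * (1 + of_real kappa * F)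
      = 1 + of_real kappa * F - of_real kappa * ((1 + of_real kappa * F) * G)"
    by (simp add: algebra_simps)
  thus ?thesis unfolding G by simp
qed

text \<open>Put \<open>u = 1 - kappa G\<close>, the inverse of \<open>1 + kappa F\<close>. Then
  \<open>u = cnj (1 + kappa F) * |u|^2\<close>, whose imaginary part reads
  \<open>Im G = Im F * |u|^2\<close>; and \<open>|1 + kappa F| >= |kappa| q\<close> bounds
  \<open>u\<close>, hence \<open>G\<close>.\<close>

lemma rank_one_bounds:
  fixes kappa q :: real and psi :: 'a
  assumes z: "Im z \<noteq> 0" and k: "kappa \<noteq> 0" and q: "0 < q" and F: "q \<le> Im (cinner psi (R z psi))"
  defines "G \<equiv> cinner psi (resolvent D (rank_one_pert A kappa psi) z psi)"
  shows "(cmod (1 - of_real kappa * G))\<^sup>2 \<le> (1 / q) * Im G"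
    and "cmod G \<le> (1 + 1 / (\<bar>kappa\<bar> * q)) / \<bar>kappa\<bar>"
proof -
  define F where "F = cinner psi (R z psi)"
  define u where "u = 1 - of_real kappa * G"
  have uF: "u * (1 + of_real kappa * F) = 1"
    unfolding u_def F_def G_def by (rule rank_one_krein[OF z])
  have u: "u = cnj (1 + of_real kappa * F) * of_real ((cmod u)\<^sup>2)"
  proof -
    have "u = u * cnj (u * (1 + of_real kappa * F))" unfolding uF by simp
    also have "\<dots> = cnj (1 + of_real kappa * F) * (u * cnj u)" by (simp only: complex_cnj_mult mult_ac)
    finally show ?thesis by (simp only: complex_norm_square)
  qed
  have "Im u = - kappa * Im F * (cmod u)\<^sup>2" by (subst u) simp
  moreover have "Im u = - kappa * Im G" by (simp add: u_def)
  ultimately have ImG: "Im G = Im F * (cmod u)\<^sup>2" using k by simp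
  have "q * (cmod u)\<^sup>2 \<le> Im G" unfolding ImG using F by (intro mult_right_mono) (auto simp: F_def)
  thus "(cmod (1 - of_real kappa * G))\<^sup>2 \<le> (1 / q) * Im G" using q by (simp add: u_def field_simps)
  have "\<bar>kappa\<bar> * q \<le> \<bar>Im (1 + of_real kappa * F)\<bar>"
    using F q by (simp add: F_def[symmetric] abs_mult mult_left_mono)
  also have "\<dots> \<le> cmod (1 + of_real kappa * F)" by (rule abs_Im_le_cmod)
  finally have "cmod u * (\<bar>kappa\<bar> * q) \<le> cmod u * cmod (1 + of_real kappa * F)"
    by (rule mult_left_mono) simp
  also have "\<dots> = 1" by (simp only: norm_mult[symmetric] uF norm_one)
  finally have "cmod u \<le> 1 / (\<bar>kappa\<bar> * q)" using k q by (simp add: field_simps)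
  moreover have "\<bar>kappa\<bar> * cmod G = cmod (1 - u)" by (simp add: u_def norm_mult)
  moreover have "cmod (1 - u) \<le> 1 + cmod u" using norm_triangle_ineq4[of 1 u] by simp
  ultimately have "\<bar>kappa\<bar> * cmod G \<le> 1 + 1 / (\<bar>kappa\<bar> * q)" by linarith
  thus "cmod G \<le> (1 + 1 / (\<bar>kappa\<bar> * q)) / \<bar>kappa\<bar>" using k by (simp add: pos_le_divide_eq mult.commute)
qed

end

section \<open>The reducing projection and the function \<open>F0\<close>\<close>

locale reduced_op = self_adjoint_op D A for D :: "'a::{complex_inner, complete_space} set" and A +
  fixes P :: "'a \<Rightarrow> 'a"
  assumes proj: "orth_projection P"
    and comm: "x \<in> D \<Longrightarrow> P x \<in> D" "x \<in> D \<Longrightarrow> P (A x) = A (P x)"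
begin

lemma proj_simps: "P (x + y) = P x + P y" "P (scaleC a x) = scaleC a (P x)" "P (P x) = P x"
    "cinner (P x) y = cinner x (P y)" "P (x - y) = P x - P y" "P 0 = 0"
proof -
  show P: "P (x + y) = P x + P y" "P (scaleC a x) = scaleC a (P x)" "P (P x) = P x"
    "cinner (P x) y = cinner x (P y)" for x y a
    using proj by (auto simp: orth_projection_def linear_on_def)
  show "P (x - y) = P x - P y"
    using P(1)[of x "scaleC (-1) y"] unfolding P(2) by (simp add: scaleC_minus_one)
  show "P 0 = 0" using P(2)[of 0 0] by simp
qed

lemma norm_perp_le: "norm (x - P x) \<le> norm x"
proof -
  have "complex_of_real ((norm (x - P x))\<^sup>2 + (norm (P x))\<^sup>2) = of_real ((norm x)\<^sup>2)"
    unfolding of_real_add cinner_self[symmetric] by (simp add: cinner_simps proj_simps)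
  hence "(norm (x - P x))\<^sup>2 + (norm (P x))\<^sup>2 = (norm x)\<^sup>2" by (simp only: of_real_eq_iff)
  hence "(norm (x - P x))\<^sup>2 \<le> (norm x)\<^sup>2" by (smt (verit) zero_le_power2)
  thus ?thesis by (rule power2_le_imp_le) simp
qed

lemma resolvent_proj: "Im z \<noteq> 0 \<Longrightarrow> R z (P x) = P (R z x)"
  by (rule resolvent_eqI)
    (simp_all add: comm resolvent_dom shift_resolvent proj_simps(1,5) proj_simps(2)[symmetric] comm(2)[symmetric]
      op_resolvent)

text \<open>In \<open>F0\<close> the compressed operator acts on the whole space and is 0 on the
  range of \<open>P\<close>. As \<open>z\<close> is nonzero, the solution with right-hand side
  \<open>psi - P psi\<close> has no component there and agrees with the full resolvent.\<close>

lemma F0_eq: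
  assumes z: "Im z \<noteq> 0"
  shows "F0 D A P psi z = cinner (psi - P psi) (R z (psi - P psi))"
proof -
  define Q where "Q x = x - P x" for x
  have QQ: "Q (Q x) = Q x" for x by (simp add: Q_def proj_simps)
  have Qs: "Q (scaleC a x) = scaleC a (Q x)" for a x by (simp add: Q_def proj_simps scaleC_simps)
  have Qd: "Q (x - y) = Q x - Q y" for x y by (simp add: Q_def proj_simps)
  have QA: "Q (A x) = A (Q x)" if "x \<in> D" for x using that by (simp add: Q_def comm op_diff)
  let ?w = "R z (Q psi)"
  have w: "?w \<in> D" by (rule resolvent_dom[OF z])
  have Qw: "Q ?w = ?w"
    using resolvent_proj[OF z, of "Q psi"] resolvent_proj[OF z, of 0]
    by (simp add: Q_def proj_simps resolvent_proj z resolvent_diff)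
  have "resolvent {x. Q x \<in> D} (\<lambda>x. Q (A (Q x))) z (Q psi) = ?w"
    unfolding resolvent_def[of "{x. Q x \<in> D}"]
  proof (rule the_equality)
    show "?w \<in> {x. Q x \<in> D} \<and> Q (A (Q ?w)) - scaleC z ?w = Q psi"
      using w by (simp add: Qw QA shift_resolvent[OF z])
    fix v assume v: "v \<in> {x. Q x \<in> D} \<and> Q (A (Q v)) - scaleC z v = Q psi"
    hence vD: "Q v \<in> D" by simp
    have zv: "scaleC z v = A (Q v) - Q psi" using v by (simp add: QA[OF vD] QQ algebra_simps)
    \<comment> \<open>All other terms of the equation lie in the range of \<open>Q\<close>, hence so
      does \<open>z v\<close>.\<close>
    have "scaleC z (Q v) = scaleC z v"
      unfolding Qs[symmetric] by (simp add: zv Qd QA[OF vD] QQ)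
    hence "scaleC (inverse z * z) (Q v) = scaleC (inverse z * z) v" by (simp only: scaleC_scaleC[symmetric])
    moreover have "z \<noteq> 0" using z by auto
    ultimately have "Q v = v" by simp
    thus "v = ?w" using vD zv by (intro resolvent_eqI[OF z, symmetric]) simp_all
  qed
  hence "F0 D A P psi z = cinner psi (Q ?w)"
    unfolding F0_def Let_def Q_def by simp
  also have "\<dots> = cinner (Q psi) (Q ?w)"
    by (simp add: Q_def cinner_simps proj_simps)
  finally show ?thesis by (simp only: Qw) (simp only: Q_def)
qed

text \<open>Both sides are \<open>Im z\<close> times a squared norm, and the vector on the left is
  the complementary projection of \<open>R z psi\<close>.\<close>

lemma Im_F0_le:
  assumes z: "0 < Im z"
  shows "Im (F0 D A P psi z) \<le> Im (cinner psi (R z psi))"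
proof -
  have z0: "Im z \<noteq> 0" using z by simp
  have "R z (psi - P psi) = R z psi - P (R z psi)" by (simp add: resolvent_diff resolvent_proj z0)
  hence "norm (R z (psi - P psi)) \<le> norm (R z psi)" by (simp add: norm_perp_le)
  thus ?thesis using z by (simp add: F0_eq Im_cinner_resolvent z0)
qed

text \<open>If \<open>psi\<close> lies in the range of \<open>A - l\<close>, then \<open>R (l + i e)\<close> stays bounded on \<open>psi - P psi\<close>.\<close>

lemma Im_F0_le_if_in_range:
  assumes eta: "eta \<in> D" "A eta - scaleC (complex_of_real l) eta = psi" and e: "0 < e"
  shows "Im (F0 D A P psi (Complex l e)) \<le> e * (2 * norm eta)\<^sup>2"
proof -
  let ?z = "Complex l e" and ?h = "eta - P eta"
  have z: "Im ?z \<noteq> 0" using e by simp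
  have zl: "?z = of_real l + \<i> * of_real e" by (simp add: complex_eq_iff)
  have h: "?h \<in> D" by (rule dom(4)[OF eta(1) comm(1)[OF eta(1)]])
  have "A ?h - scaleC (of_real l) ?h = psi - P psi"
    unfolding eta(2)[symmetric] by (simp add: op_diff eta(1) comm proj_simps scaleC_simps)
  hence Ah: "A ?h = (psi - P psi) + scaleC (of_real l) ?h" by (simp only: diff_eq_eq)
  \<comment> \<open>From \<open>(A - z) h = (psi - P psi) - i e h\<close>. The bound
    \<open>e * norm (R z h) <= norm h\<close> then leaves at most \<open>2 * norm eta\<close>,
    uniformly in \<open>e\<close>.\<close>
  have "R ?z (psi - P psi) = ?h + scaleC (\<i> * of_real e) (R ?z ?h)"
  proof -
    define v where "v = R ?z ?h"
    have v: "v \<in> D" "A v = ?h + scaleC ?z v" by (simp_all only: v_def resolvent_dom[OF z] op_resolvent[OF z])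
    have "A (?h + scaleC (\<i> * of_real e) v) = A ?h + scaleC (\<i> * of_real e) (?h + scaleC ?z v)"
      by (simp only: op_add[OF h dom(3)[OF v(1)]] op_scaleC[OF v(1)] v(2))
    also have "\<dots> = (psi - P psi) + scaleC ?z (?h + scaleC (\<i> * of_real e) v)"
      unfolding Ah scaleC_add_right scaleC_scaleC mult.commute[of _ ?z]
      unfolding zl by (simp only: scaleC_add_left add_ac)
    finally have "A (?h + scaleC (\<i> * of_real e) v) - scaleC ?z (?h + scaleC (\<i> * of_real e) v) = psi - P psi"
      by simp
    with dom(2)[OF h dom(3)[OF v(1)]] show ?thesis
      unfolding v_def[symmetric] by (rule resolvent_eqI[OF z])
  qed
  hence "norm (R ?z (psi - P psi)) \<le> norm ?h + e * norm (R ?z ?h)"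
    using norm_triangle_ineq[of ?h "scaleC (\<i> * of_real e) (R ?z ?h)"] e by (simp add: norm_mult)
  also have "\<dots> \<le> 2 * norm eta"
    using norm_resolvent[OF z, of ?h] norm_perp_le[of eta] e by simp
  finally have "(norm (R ?z (psi - P psi)))\<^sup>2 \<le> (2 * norm eta)\<^sup>2" by (rule power_mono) simp
  thus ?thesis using e by (simp add: F0_eq[OF z] Im_cinner_resolvent[OF z] mult_left_mono)
qed

end

section \<open>Exclusion of eigenvalues, then spectrum of the absolutely continuous part\<close>

theorem theorem3p2:
  fixes D :: "'a::{complex_inner, complete_space} set"
    and H0 :: "'a \<Rightarrow> 'a" and P :: "'a \<Rightarrow> 'a" and psi :: "'a"
    and J :: "real set"
  assumes sa: "self_adjoint D H0"
    and psi_norm: "norm psi = 1"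
    and proj: "orth_projection P"
    and comm: "\<forall>x\<in>D. P x \<in> D \<and> P (H0 x) = H0 (P x)"
    and J_open: "open J" and J_interval: "is_interval J"
    and lim: "\<forall>lam\<in>J. \<exists>L. ((\<lambda>eps. F0 D H0 P psi (complex_of_real lam + \<i> * complex_of_real eps))
                              \<longlongrightarrow> L) (at_right 0) \<and> Im L > 0"
    and eig: "\<forall>lam\<in>J. \<forall>phi\<in>D. phi \<noteq> 0 \<and> H0 phi = scaleC (complex_of_real lam) phi \<longrightarrow>
               cinner phi psi \<noteq> 0 \<and>
               (\<forall>chi\<in>D. H0 chi = scaleC (complex_of_real lam) chi \<longrightarrow> (\<exists>c. chi = scaleC c phi))"
  shows "\<forall>kappa::real. kappa \<noteq> 0 \<longrightarrow>
           J \<subseteq> sigma_ac D (rank_one_pert H0 kappa psi) \<and>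
           J \<inter> sigma_p D (rank_one_pert H0 kappa psi) = {}"
proof (intro allI impI)
  fix kappa :: real assume k: "kappa \<noteq> 0"
  define H where "H = rank_one_pert H0 kappa psi"
  interpret reduced_op D H0 P by unfold_locales (use sa proj comm in auto)
  interpret H: self_adjoint_op D H
    by unfold_locales (simp add: H_def self_adjoint_rank_one_pert)
  obtain M where M: "real_distribution M" "\<And>k. cinner psi ((H.V ^^ k) psi) = (\<integral>t. cis (real k * t) \<partial>M)"
    using H.herglotz[OF psi_norm] by blast
  interpret H: spectral_op D H M psi
    by (intro spectral_op.intro spectral_rep.intro spectral_rep_axioms.intro M H.self_adjoint_op_axioms
        H.unitary_pair_axioms)
  have lim': "\<exists>L. ((\<lambda>e. Im (F0 D H0 P psi (Complex l e))) \<longlongrightarrow> L) (at_right 0) \<and> 0 < L" if "l \<in> J" for l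
  proof -
    obtain L where "((\<lambda>e. F0 D H0 P psi (Complex l e)) \<longlongrightarrow> L) (at_right 0)" "0 < Im L"
      using lim \<open>l \<in> J\<close> unfolding Complex_eq by blast
    thus ?thesis using tendsto_Im by blast
  qed

  have "J \<inter> sigma_p D H = {}"
  proof (rule ccontr)
    assume "J \<inter> sigma_p D H \<noteq> {}"
    then obtain l phi where l: "l \<in> J" and phi: "phi \<in> D" "phi \<noteq> 0" and ev: "H phi = scaleC (of_real l) phi"
      by (auto simp: sigma_p_def)
    define c where "c = of_real kappa * cinner psi phi"
    have H0phi: "H0 phi - scaleC (of_real l) phi = - scaleC c psi"
      using ev by (simp add: H_def rank_one_pert_def c_def algebra_simps)
    have "c \<noteq> 0"
    proof
      assume c: "c = 0"
      hence "H0 phi = scaleC (of_real l) phi" using H0phi by simp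
      hence "cinner phi psi \<noteq> 0" using eig l phi by blast
      moreover have "cinner psi phi = 0" using c k by (simp add: c_def)
      ultimately show False by (metis cinner_conj complex_cnj_zero)
    qed
    \<comment> \<open>Normalised so that \<open>(H0 - l) phi = - c psi\<close> becomes
      \<open>(H0 - l) eta = psi\<close>.\<close>
    define eta where "eta = scaleC (- 1 / c) phi"
    have eta: "eta \<in> D" unfolding eta_def by (rule dom(3)[OF phi(1)])
    have "H0 eta - scaleC (of_real l) eta = scaleC (- 1 / c) (H0 phi - scaleC (of_real l) phi)"
      unfolding eta_def op_scaleC[OF phi(1)] scaleC_diff_right scaleC_scaleC by (simp only: mult.commute)
    also have "\<dots> = psi"
      unfolding H0phi scaleC_minus_right scaleC_minus_left[symmetric] scaleC_scaleC using \<open>c \<noteq> 0\<close> by simp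
    finally have eta': "H0 eta - scaleC (of_real l) eta = psi" .
    obtain L where L: "((\<lambda>e. Im (F0 D H0 P psi (Complex l e))) \<longlongrightarrow> L) (at_right 0)" "0 < L"
      using lim'[OF l] by blast
    have "L \<le> 0 * (2 * norm eta)\<^sup>2"
    proof (rule tendsto_le[OF _ _ L(1)])
      show "((\<lambda>e. e * (2 * norm eta)\<^sup>2) \<longlongrightarrow> 0 * (2 * norm eta)\<^sup>2) (at_right 0)"
        by (intro tendsto_intros)
      show "\<forall>\<^sub>F e in at_right 0. Im (F0 D H0 P psi (Complex l e)) \<le> e * (2 * norm eta)\<^sup>2"
        using eventually_at_right_less[of "0::real"]
        by eventually_elim (rule Im_F0_le_if_in_range[OF eta eta'])
    qed simp
    with L(2) show False by simp
  qed

  moreover have "J \<subseteq> sigma_ac D H"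
  proof
    fix l0 assume l0: "l0 \<in> J"
    show "l0 \<in> sigma_ac D H"
    proof (rule ccontr)
      assume "l0 \<notin> sigma_ac D H"
      then obtain C where C: "\<forall>u\<in>D \<inter> ac_subspace D H. norm u \<le> C * norm (H u - scaleC (of_real l0) u)"
        unfolding sigma_ac_def spectrum_on_def by blast
      \<comment> \<open>Chosen so that \<open>|C| d < 1\<close>; the absolute value is taken because
        the sign of \<open>C\<close> is unknown.\<close>
      define d where "d = 1 / (\<bar>C\<bar> + 1)"
      have d: "0 < d" by (simp add: d_def add_nonneg_pos)
      have Cd: "\<bar>C\<bar> * d < 1" by (simp add: d_def pos_divide_less_eq add_nonneg_pos)
      obtain s where s: "0 < s" "cball l0 s \<subseteq> J" using J_open l0 open_contains_cball by blast
      \<comment> \<open>Radius \<open>s\<close> keeps the interval inside \<open>J\<close>; radius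
        \<open>d\<close> makes every point of it an approximate eigenvalue location for
        \<open>l0\<close> with error at most \<open>d\<close>.\<close>
      define s' where "s' = min s d"
      have s': "0 < s'" using s d by (simp add: s'_def)
      have "{l0 - s'..l0 + s'} \<subseteq> cball l0 s" by (auto simp: s'_def cball_eq_atLeastAtMost)
      with s have s'J: "{l0 - s'..l0 + s'} \<subseteq> J" by blast
      let ?F = "\<lambda>l e. Im (cinner psi (R (Complex l e) psi))"
      have "\<exists>n. \<forall>e. 0 < e \<and> e < 1 / real (Suc n) \<longrightarrow> 1 / real (Suc n) \<le> ?F l e" if l: "l \<in> {l0 - s'..l0 + s'}" for l
      proof -
        obtain L where L: "((\<lambda>e. Im (F0 D H0 P psi (Complex l e))) \<longlongrightarrow> L) (at_right 0)" "0 < L"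
          using lim' l s'J by blast
        have "\<forall>\<^sub>F e in at_right 0. L / 2 < Im (F0 D H0 P psi (Complex l e))"
          using L by (intro order_tendstoD(1)[OF L(1)]) simp
        then obtain b where b: "0 < b" "\<And>e. 0 < e \<Longrightarrow> e < b \<Longrightarrow> L / 2 < Im (F0 D H0 P psi (Complex l e))"
          by (auto simp: eventually_at_right_field)
        \<comment> \<open>One index serves both as the range of admissible \<open>e\<close> and as
          the lower bound, the form that the Baire lemma expects.\<close>
        obtain n where n: "1 / real (Suc n) < min b (L / 2)"
          using reals_Archimedean[of "min b (L / 2)"] b(1) L(2) by (auto simp: inverse_eq_divide)
        have "1 / real (Suc n) \<le> ?F l e" if "0 < e" "e < 1 / real (Suc n)" for e
          using b(2)[of e] Im_F0_le[of "Complex l e" psi] n that by simp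
        thus ?thesis by blast
      qed
      then obtain a b n where ab: "l0 - s' \<le> a" "a < b" "b \<le> l0 + s'"
        and F: "\<And>l e. a \<le> l \<Longrightarrow> l \<le> b \<Longrightarrow> 0 < e \<Longrightarrow> e < 1 / real (Suc n) \<Longrightarrow> 1 / real (Suc n) \<le> ?F l e"
        by (rule Baire_uniform_lower_bound[of "l0 - s'" "l0 + s'" ?F, rotated 2])
          (use s' in \<open>auto intro!: continuous_on_Im continuous_cinner_resolvent\<close>)
      define q where "q = 1 / real (Suc n)"
      have q: "0 < q" by (simp add: q_def)
      note bounds = rank_one_bounds[where psi = psi, OF _ k q, folded H_def]
      have nonnull: "measure M (H.line_part {a<..<b}) \<noteq> 0"
      proof (rule H.line_part_nonnull[OF ab(2) q, of "1 / q" kappa])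
        fix l e assume "a < l" "l < b" "0 < e" "e < q"
        thus "(cmod (1 - of_real kappa * cinner psi (H.R (Complex l e) psi)))\<^sup>2
            \<le> 1 / q * Im (cinner psi (H.R (Complex l e) psi))"
          using F[of l e] by (intro bounds) (auto simp: q_def)
      qed (use q in simp)
      obtain phi where phi: "phi \<in> D \<inter> ac_subspace D H" "phi \<noteq> 0"
        "norm (H phi - scaleC (of_real l0) phi) \<le> d * norm phi"
      proof (rule exE[OF H.ac_approximate_eigenvector[unfolded Bex_def, OF ab(2) q less_imp_le[OF d] _ nonnull]])
        show "cmod (cinner psi (H.R (Complex l e) psi)) \<le> (1 + 1 / (\<bar>kappa\<bar> * q)) / \<bar>kappa\<bar>"
          if "a \<le> l" "l \<le> b" "0 < e" "e < q" for l e
          using that F by (intro bounds) (auto simp: q_def)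
        show "\<bar>x - l0\<bar> \<le> d" if "a < x" "x < b" for x
          using that ab by (auto simp: s'_def)
      qed blast
      \<comment> \<open>The resolvent estimate and the approximate eigenvector property together
        give \<open>norm phi < norm phi\<close>.\<close>
      have "norm phi \<le> \<bar>C\<bar> * norm (H phi - scaleC (of_real l0) phi)"
        using bspec[OF C phi(1)] by (rule order_trans) (simp add: mult_right_mono)
      also have "\<dots> \<le> \<bar>C\<bar> * (d * norm phi)" using phi(3) by (intro mult_left_mono) auto
      also have "\<dots> < 1 * norm phi"
        unfolding mult.assoc[symmetric] using Cd phi(2) by (intro mult_strict_right_mono) auto
      finally show False by simp
    qed
  qed
  ultimately show "J \<subseteq> sigma_ac D (rank_one_pert H0 kappa psi) \<and> J \<inter> sigma_p D (rank_one_pert H0 kappa psi) = {}"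
    unfolding H_def by blast
qed

end
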